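(* Let $\mathbf n=(n_1,\dots,n_k)\in\mathbb N^k$, let $\mathcal H$ be a Hilbert space and let $F:\mathbf B_{\mathbf n}(\mathcal H)\to B(\mathcal H)$ be a bounded free holomorphic function. If there exists $\mathbf X_0\in\mathbf B_{\mathbf n}(\mathcal H)$ such that $$\|F(\mathbf X)\|\le\|F(\mathbf X_0)\|,\qquad\mathbf X\in\mathbf B_{\mathbf n}(\mathcal H),$$ then $F$ must be a constant.
   Context: **Polyball.** For a complex Hilbert space $\mathcal H$, $B(\mathcal H)^{n_1}\times_c\cdots\times_c B(\mathcal H)^{n_k}$ is the set of tuples $\mathbf X=(X_1,\dots,X_k)$, $X_i=(X_{i,1},\dots,X_{i,n_i})\in B(\mathcal H)^{n_i}$, such that each entry of $X_s$ commutes with each entry of $X_t$ whenever $s\neq t$ (entries of a single $X_s$ need not commute). Put $\Phi_{X_i}(Y)=\sum_{j=1}^{n_i}X_{i,j}YX_{i,j}^*$ and $\mathbf\Delta_{\mathbf X}=(id-\Phi_{X_1})\circ\cdots\circ(id-\Phi_{X_k})$ on $B(\mathcal H)$. The regular polyball $\mathbf B_{\mathbf n}(\mathcal H)$ is the set of all such $\mathbf X$ with $\|\sum_jX_{i,j}X_{i,j}^*\|<1$ for each $i$ and $\mathbf\Delta_{\mathbf X}(I)>0$ (positive and invertible). **Free holomorphic functions.** $\mathbb F_{n_i}^+$ is the unital free semigroup on $g^i_1,\dots,g^i_{n_i}$, with word length $|\cdot|$. For $\alpha=g^i_{j_1}\cdots g^i_{j_p}$ put $X_{i,\alpha}=X_{i,j_1}\cdots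 X_{i,j_p}$ ($I$ for the empty word), and $X_{(\alpha)}=X_{1,\alpha_1}\cdots X_{k,\alpha_k}$ for $(\alpha)=(\alpha_1,\dots,\alpha_k)$. A free holomorphic function (scalar coefficients) on the abstract polyball $\mathbf B_{\mathbf n}=\{\mathbf B_{\mathbf n}(\mathcal H):\mathcal H\text{ a Hilbert space}\}$ is a formal series $F=\sum_{(\alpha)}a_{(\alpha)}Z_{(\alpha)}$, $a_{(\alpha)}\in\mathbb C$, such that $F(\mathbf X)=\sum_{(p_1,\dots,p_k)\in\mathbb Z_+^k}\sum_{|\alpha_i|=p_i}a_{(\alpha)}X_{(\alpha)}$ converges in operator norm for all $\mathbf X\in\mathbf B_{\mathbf n}(\mathcal H)$ and all $\mathcal H$. Writing $F:\mathbf B_{\mathbf n}(\mathcal H)\to B(\mathcal H)$ refers to the map $\mathbf X\mapsto F(\mathbf X)$ (the representation of $F$ on $\mathcal H$). $F$ is bounded if $\|F\|_\infty:=\sup\|F(\mathbf X)\|<\infty$, the supremum over all $\mathbf X\in\mathbf B_{\mathbf n}(\mathcal H)$ and all Hilbert spaces $\mathcal H$. *)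

theory Defs
  imports "HOL-Analysis.Analysis" "HOL-Algebra.Module"
begin

section \<open>Complex Hilbert spaces with explicit carrier\<close>

text \<open>
  Being bounded or free holomorphic on a polyball quantifies over all Hilbert spaces, so a
  Hilbert space has to be a value rather than a type. It is an HOL-Algebra module over the
  complex numbers with an inner product, linear in its first argument. (The ring
  multiplication and unit that every \<open>module\<close> record carries are not used.)
\<close>

definition complex_ring :: "complex ring" where
  "complex_ring = \<lparr>carrier = UNIV, mult = (*), one = 1, zero = 0, add = (+)\<rparr>"

record 'v hilbert = "(complex, 'v) module" +
  ip :: "'v \<Rightarrow> 'v \<Rightarrow> complex"

definition hnorm :: "'v hilbert \<Rightarrow> 'v \<Rightarrow> real" where
  "hnorm H v = sqrt (Re (ip H v v))"

locale hilbert_space = module complex_ring H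
  for H :: "'v hilbert" (structure) +
  assumes ip_add: "\<lbrakk>u \<in> carrier H; v \<in> carrier H; w \<in> carrier H\<rbrakk>
      \<Longrightarrow> ip H (u \<oplus> v) w = ip H u w + ip H v w"
    and ip_smult: "\<lbrakk>v \<in> carrier H; w \<in> carrier H\<rbrakk> \<Longrightarrow> ip H (c \<odot> v) w = c * ip H v w"
    and ip_cnj: "\<lbrakk>v \<in> carrier H; w \<in> carrier H\<rbrakk> \<Longrightarrow> ip H w v = cnj (ip H v w)"
    and ip_pos: "\<lbrakk>v \<in> carrier H; v \<noteq> \<zero>\<rbrakk> \<Longrightarrow> 0 < Re (ip H v v)"
    and complete: "\<lbrakk>range s \<subseteq> carrier H;
        \<And>e. 0 < e \<Longrightarrow> \<exists>N. \<forall>m\<ge>N. \<forall>n\<ge>N. hnorm H (s m \<ominus> s n) < e\<rbrakk>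
      \<Longrightarrow> \<exists>l\<in>carrier H. (\<lambda>n. hnorm H (s n \<ominus> l)) \<longlonglongrightarrow> 0"


section \<open>Bounded operators\<close>

text \<open>
  Operators are extensional functions, so that equality of operators is equality on the carrier.
\<close>

definition bounded_ops :: "'v hilbert \<Rightarrow> ('v \<Rightarrow> 'v) set" where
  "bounded_ops H = {A \<in> carrier H \<rightarrow>\<^sub>E carrier H.
     (\<forall>v\<in>carrier H. \<forall>w\<in>carrier H. A (v \<oplus>\<^bsub>H\<^esub> w) = A v \<oplus>\<^bsub>H\<^esub> A w) \<and>
     (\<forall>c. \<forall>v\<in>carrier H. A (c \<odot>\<^bsub>H\<^esub> v) = c \<odot>\<^bsub>H\<^esub> A v) \<and>
     (\<exists>M. \<forall>v\<in>carrier H. hnorm H (A v) \<le> M * hnorm H v)}"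

text \<open>\<open>B(H)\<close> with all its algebraic structure; \<open>compose\<close> is composition of extensional functions.\<close>

definition BH :: "'v hilbert \<Rightarrow> (complex, 'v \<Rightarrow> 'v) module" where
  "BH H = \<lparr> carrier = bounded_ops H,
     mult = compose (carrier H),
     one = (\<lambda>v\<in>carrier H. v),
     zero = (\<lambda>v\<in>carrier H. \<zero>\<^bsub>H\<^esub>),
     add = (\<lambda>A B. \<lambda>v\<in>carrier H. A v \<oplus>\<^bsub>H\<^esub> B v),
     smult = (\<lambda>c A. \<lambda>v\<in>carrier H. c \<odot>\<^bsub>H\<^esub> A v) \<rparr>"

definition opnorm :: "'v hilbert \<Rightarrow> ('v \<Rightarrow> 'v) \<Rightarrow> real" where
  "opnorm H A = (SUP v\<in>{v \<in> carrier H. hnorm H v \<le> 1}. hnorm H (A v))"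

definition adj :: "'v hilbert \<Rightarrow> ('v \<Rightarrow> 'v) \<Rightarrow> ('v \<Rightarrow> 'v)" where
  "adj H A = (THE B. B \<in> carrier (BH H) \<and>
     (\<forall>v\<in>carrier H. \<forall>w\<in>carrier H. ip H (A v) w = ip H v (B w)))"

definition positive_op :: "'v hilbert \<Rightarrow> ('v \<Rightarrow> 'v) \<Rightarrow> bool" where
  "positive_op H T \<longleftrightarrow> T \<in> carrier (BH H) \<and> (\<forall>v\<in>carrier H. ip H (T v) v \<in> \<real>\<^sub>\<ge>\<^sub>0)"

text \<open>
  Unordered sum of a family of operators, in operator norm; this is \<open>has_sum\<close> for \<open>B(H)\<close>.
\<close>

definition op_has_sum ::
    "'v hilbert \<Rightarrow> ('i \<Rightarrow> 'v \<Rightarrow> 'v) \<Rightarrow> 'i set \<Rightarrow> ('v \<Rightarrow> 'v) \<Rightarrow> bool" where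
  "op_has_sum H f I T \<longleftrightarrow> T \<in> carrier (BH H) \<and>
     ((\<lambda>P. opnorm H ((\<Oplus>\<^bsub>BH H\<^esub>p\<in>P. f p) \<ominus>\<^bsub>BH H\<^esub> T)) \<longlongrightarrow> 0) (finite_subsets_at_top I)"


section \<open>The regular polyball\<close>

text \<open>
  A tuple \<open>X = (X\<^sub>1, \<dots>, X\<^sub>k)\<close> of row tuples \<open>X\<^sub>i = (X\<^sub>i\<^sub>,\<^sub>1, \<dots>, X\<^sub>i\<^sub>,\<^sub>n\<^sub>i)\<close>
  is a list of lists of operators, and \<open>n = (n\<^sub>1, \<dots>, n\<^sub>k)\<close> is a list; indices start at 0.
\<close>

definition Phi :: "'v hilbert \<Rightarrow> ('v \<Rightarrow> 'v) list \<Rightarrow> ('v \<Rightarrow> 'v) \<Rightarrow> ('v \<Rightarrow> 'v)" where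
  "Phi H x Y = (\<Oplus>\<^bsub>BH H\<^esub>j\<in>{..<length x}. (x ! j) \<otimes>\<^bsub>BH H\<^esub> Y \<otimes>\<^bsub>BH H\<^esub> adj H (x ! j))"

definition Delta :: "'v hilbert \<Rightarrow> ('v \<Rightarrow> 'v) list list \<Rightarrow> ('v \<Rightarrow> 'v) \<Rightarrow> ('v \<Rightarrow> 'v)" where
  "Delta H X = foldr (\<lambda>x Y. Y \<ominus>\<^bsub>BH H\<^esub> Phi H x Y) X"

definition polyball :: "'v hilbert \<Rightarrow> nat list \<Rightarrow> ('v \<Rightarrow> 'v) list list set" where
  "polyball H n = {X. map length X = n \<and>
     (\<forall>x\<in>set X. set x \<subseteq> carrier (BH H)) \<and>
     (\<forall>s<length X. \<forall>t<length X. s \<noteq> t \<longrightarrow>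
        (\<forall>A\<in>set (X ! s). \<forall>B\<in>set (X ! t). A \<otimes>\<^bsub>BH H\<^esub> B = B \<otimes>\<^bsub>BH H\<^esub> A)) \<and>
     (\<forall>x\<in>set X. opnorm H (\<Oplus>\<^bsub>BH H\<^esub>j\<in>{..<length x}. (x ! j) \<otimes>\<^bsub>BH H\<^esub> adj H (x ! j)) < 1) \<and>
     positive_op H (Delta H X \<one>\<^bsub>BH H\<^esub>) \<and> Delta H X \<one>\<^bsub>BH H\<^esub> \<in> Units (BH H)}"


section \<open>Free holomorphic functions\<close>

text \<open>
  A multiword \<open>(\<alpha>) = (\<alpha>\<^sub>1, \<dots>, \<alpha>\<^sub>k)\<close> is a list of words, the letters of \<open>\<alpha>\<^sub>i\<close> being the
  indices below \<open>n\<^sub>i\<close>. A formal series is its coefficient function on multiwords; the values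
  on ill-formed multiwords play no role.
\<close>

definition multiwords :: "nat list \<Rightarrow> nat list \<Rightarrow> nat list list set" where
  "multiwords n p = {\<alpha>. map length \<alpha> = p \<and> list_all2 (\<lambda>w m. set w \<subseteq> {..<m}) \<alpha> n}"

definition op_word :: "'v hilbert \<Rightarrow> ('v \<Rightarrow> 'v) list \<Rightarrow> nat list \<Rightarrow> ('v \<Rightarrow> 'v)" where
  "op_word H x w = foldr (\<lambda>j Y. (x ! j) \<otimes>\<^bsub>BH H\<^esub> Y) w \<one>\<^bsub>BH H\<^esub>"

definition op_multiword ::
    "'v hilbert \<Rightarrow> ('v \<Rightarrow> 'v) list list \<Rightarrow> nat list list \<Rightarrow> ('v \<Rightarrow> 'v)" where
  "op_multiword H X \<alpha> = foldr (\<lambda>(x, w) Y. op_word H x w \<otimes>\<^bsub>BH H\<^esub> Y) (zip X \<alpha>) \<one>\<^bsub>BH H\<^esub>"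

definition homogeneous_part :: "'v hilbert \<Rightarrow> nat list \<Rightarrow> (nat list list \<Rightarrow> complex)
    \<Rightarrow> ('v \<Rightarrow> 'v) list list \<Rightarrow> nat list \<Rightarrow> ('v \<Rightarrow> 'v)" where
  "homogeneous_part H n a X p =
     (\<Oplus>\<^bsub>BH H\<^esub>\<alpha>\<in>multiwords n p. a \<alpha> \<odot>\<^bsub>BH H\<^esub> op_multiword H X \<alpha>)"

definition series_converges_to :: "'v hilbert \<Rightarrow> nat list \<Rightarrow> (nat list list \<Rightarrow> complex)
    \<Rightarrow> ('v \<Rightarrow> 'v) list list \<Rightarrow> ('v \<Rightarrow> 'v) \<Rightarrow> bool" where
  "series_converges_to H n a X T \<longleftrightarrow>
     op_has_sum H (homogeneous_part H n a X) {p. length p = length n} T"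

text \<open>The representation \<open>X \<mapsto> F(X)\<close> on \<open>H\<close> of the formal series with coefficients \<open>a\<close>.\<close>

definition free_eval :: "'v hilbert \<Rightarrow> nat list \<Rightarrow> (nat list list \<Rightarrow> complex)
    \<Rightarrow> ('v \<Rightarrow> 'v) list list \<Rightarrow> ('v \<Rightarrow> 'v)" where
  "free_eval H n a X = (THE T. series_converges_to H n a X T)"

text \<open>
  ``All Hilbert spaces'' means all Hilbert space structures on subsets of the universe \<open>'v\<close>,
  which stays an arbitrary type. Nothing is lost: a nonzero Hilbert space in \<open>'v\<close> has at least
  the cardinality of the continuum, so that every separable Hilbert space has a copy in \<open>'v\<close>,
  and convergence and boundedness on all polyballs are already decided by the separable spaces.
\<close>

definition free_holomorphic ::
    "'v itself \<Rightarrow> nat list \<Rightarrow> (nat list list \<Rightarrow> complex) \<Rightarrow> bool" where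
  "free_holomorphic _ n a \<longleftrightarrow>
     (\<forall>K :: 'v hilbert. hilbert_space K \<longrightarrow>
        (\<forall>X\<in>polyball K n. \<exists>T. series_converges_to K n a X T))"

definition free_bounded ::
    "'v itself \<Rightarrow> nat list \<Rightarrow> (nat list list \<Rightarrow> complex) \<Rightarrow> bool" where
  "free_bounded _ n a \<longleftrightarrow>
     bdd_above {opnorm K (free_eval K n a X) | (K :: 'v hilbert) X.
       hilbert_space K \<and> X \<in> polyball K n}"

end

theory Submission
  imports Defs "HOL-Complex_Analysis.Complex_Analysis"
begin

text \<open>
  Let \<open>F\<close> have constant coefficient \<open>a\<^sub>0\<close>, so that \<open>F(0) = a\<^sub>0 I\<close>. Through every point \<open>X\<close> of the
  polyball runs a disc: there is \<open>\<rho> > 1\<close> such that \<open>z X\<close> belongs to the polyball for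
  \<open>\<bar>z\<bar> < \<rho>\<close> (\<open>polyball_disc\<close>). On this disc every matrix coefficient \<open>\<langle>F(z X) u, v\<rangle>\<close> is
  holomorphic, because the part of \<open>F\<close> of multidegree \<open>p\<close> is multiplied by \<open>z\<^bsup>\<bar>p\<bar>\<^esup>\<close>, and its value
  at the centre is \<open>a\<^sub>0 \<langle>u, v\<rangle>\<close> (\<open>matrix_coefficient_along_disc\<close>).

  Suppose that \<open>\<parallel>F\<parallel>\<close> attains its maximum \<open>M\<close> over the polyball of \<open>H\<close> at \<open>X\<^sub>0\<close>. In the disc through
  \<open>X\<^sub>0\<close> the matrix coefficients for \<open>u\<close>, \<open>v\<close> in the unit ball are bounded by \<open>M\<close>, and at the centre
  by \<open>\<bar>a\<^sub>0\<bar>\<close>. If \<open>\<bar>a\<^sub>0\<bar> < M\<close>, the Schwarz-Pick inequality keeps all of them below some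
  \<open>\<theta> < M\<close> at \<open>z = 1\<close>, where \<open>\<theta>\<close> depends on \<open>M\<close>, \<open>\<bar>a\<^sub>0\<bar>\<close> and \<open>\<rho>\<close> alone; then \<open>\<parallel>F(X\<^sub>0)\<parallel> \<le> \<theta>\<close>, a
  contradiction. So \<open>M \<le> \<bar>a\<^sub>0\<bar>\<close> (\<open>maximum_le_constant_coefficient\<close>). Now take any \<open>X\<close> and any
  \<open>u\<close>. The modulus of \<open>\<langle>F(z X) u, u\<rangle>\<close> is at most \<open>\<bar>a\<^sub>0\<bar> \<parallel>u\<parallel>\<^sup>2\<close>, which is its value at the centre, so
  this function is constant, and \<open>\<langle>F(X) u, a\<^sub>0 u\<rangle> = \<parallel>a\<^sub>0 u\<parallel>\<^sup>2\<close>. Together with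
  \<open>\<parallel>F(X) u\<parallel> \<le> \<parallel>a\<^sub>0 u\<parallel>\<close> this forces \<open>F(X) u = a\<^sub>0 u\<close> (\<open>bounded_by_constant_coefficient\<close>).

  The geometric point is the disc. Replacing \<open>X\<close> by \<open>z X\<close> replaces each \<open>\<Phi>\<^sub>i\<close> by \<open>t \<Phi>\<^sub>i\<close> with
  \<open>t = \<bar>z\<bar>\<^sup>2\<close>, and the claim is that \<open>(id - t \<Phi>\<^sub>1) \<circ> \<dots> \<circ> (id - t \<Phi>\<^sub>k)\<close> still maps \<open>I\<close> to an operator with a
  positive lower bound. The weights \<open>t\<close> are introduced one block at a time, which is possible
  because the \<open>\<Phi>\<^sub>i\<close> commute: if \<open>Y - \<Phi>\<^sub>i(Y) \<ge> \<delta>\<close> then also \<open>Y \<ge> \<delta>\<close>, since \<open>\<Phi>\<^sub>i\<close> is a strict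
  contraction, and for \<open>t \<le> 1\<close> the operator \<open>Y - t \<Phi>\<^sub>i(Y)\<close> is a convex combination of the two
  (\<open>defect_step_change_weight\<close>); for \<open>t\<close> slightly above \<open>1\<close> the bound deteriorates slightly. All
  this takes place for quadratic forms. Riesz representation (\<open>Riesz_representation_coercive\<close>)
  then supplies the adjoints and turns lower bounds of forms into invertibility.
\<close>

lemma complex_ring_simps [simp]:
  "carrier complex_ring = UNIV" "mult complex_ring = (*)" "one complex_ring = 1"
  "zero complex_ring = 0" "add complex_ring = (+)"
  by (simp_all add: complex_ring_def)

context hilbert_space
begin

section \<open>Inner product geometry\<close>

lemma smult_in [simp, intro]: "v \<in> carrier H \<Longrightarrow> c \<odot> v \<in> carrier H"
  using smult_closed[of c v] by simp

lemma minus_in [simp, intro]: "u \<in> carrier H \<Longrightarrow> v \<in> carrier H \<Longrightarrow> u \<ominus> v \<in> carrier H"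
  by (rule M.minus_closed)

lemma ip_add_right:
  "\<lbrakk>u \<in> carrier H; v \<in> carrier H; w \<in> carrier H\<rbrakk> \<Longrightarrow> ip H u (v \<oplus> w) = ip H u v + ip H u w"
  using ip_add[of v w u] ip_cnj[of u "v \<oplus> w"] ip_cnj[of u v] ip_cnj[of u w]
  by (metis M.a_closed complex_cnj_add complex_cnj_cnj)

lemma ip_smult_right:
  "\<lbrakk>v \<in> carrier H; w \<in> carrier H\<rbrakk> \<Longrightarrow> ip H v (c \<odot> w) = cnj c * ip H v w"
  by (metis ip_cnj ip_smult smult_in complex_cnj_mult)

lemma ip_zero_left [simp]: "w \<in> carrier H \<Longrightarrow> ip H \<zero> w = 0"
  using ip_add[of \<zero> \<zero> w] by simp

lemma ip_zero_right [simp]: "w \<in> carrier H \<Longrightarrow> ip H w \<zero> = 0"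
  using ip_add_right[of w \<zero> \<zero>] by simp

lemma ip_neg: "\<lbrakk>v \<in> carrier H; w \<in> carrier H\<rbrakk> \<Longrightarrow> ip H (\<ominus> v) w = - ip H v w"
  using ip_add[of v "\<ominus> v" w] by (simp add: M.r_neg eq_neg_iff_add_eq_0 add.commute)

lemma ip_diff:
  "\<lbrakk>u \<in> carrier H; v \<in> carrier H; w \<in> carrier H\<rbrakk> \<Longrightarrow> ip H (u \<ominus> v) w = ip H u w - ip H v w"
  by (simp add: a_minus_def ip_add ip_neg)

lemma ip_diff_right:
  "\<lbrakk>u \<in> carrier H; v \<in> carrier H; w \<in> carrier H\<rbrakk> \<Longrightarrow> ip H w (u \<ominus> v) = ip H w u - ip H w v"
  by (metis ip_diff ip_cnj minus_in complex_cnj_diff)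

lemmas ip_simps = ip_add ip_add_right ip_smult ip_smult_right ip_diff ip_diff_right

lemma ip_self_nonneg: "v \<in> carrier H \<Longrightarrow> 0 \<le> Re (ip H v v)"
  using ip_pos[of v] by (cases "v = \<zero>") auto

lemma hnorm_nonneg [simp]: "v \<in> carrier H \<Longrightarrow> 0 \<le> hnorm H v"
  by (simp add: hnorm_def ip_self_nonneg)

lemma ip_self: "v \<in> carrier H \<Longrightarrow> ip H v v = of_real ((hnorm H v)\<^sup>2)"
  using ip_cnj[of v v] ip_self_nonneg[of v]
  by (auto simp: hnorm_def complex_eq_iff)

lemma Re_ip_self: "v \<in> carrier H \<Longrightarrow> Re (ip H v v) = (hnorm H v)\<^sup>2"
  by (simp add: ip_self)

lemma hnorm_eq_0: "v \<in> carrier H \<Longrightarrow> hnorm H v = 0 \<longleftrightarrow> v = \<zero>"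
  using ip_pos[of v] by (cases "v = \<zero>") (auto simp: hnorm_def)

lemma hnorm_zero [simp]: "hnorm H \<zero> = 0"
  by (simp add: hnorm_eq_0)

lemma hnorm_smult: "v \<in> carrier H \<Longrightarrow> hnorm H (c \<odot> v) = cmod c * hnorm H v"
proof -
  assume v: "v \<in> carrier H"
  have "complex_of_real ((hnorm H (c \<odot> v))\<^sup>2) = ip H (c \<odot> v) (c \<odot> v)"
    using v by (simp only: ip_self smult_in)
  also have "\<dots> = c * cnj c * ip H v v"
    using v by (simp add: ip_simps)
  also have "\<dots> = of_real ((cmod c * hnorm H v)\<^sup>2)"
    using v by (simp only: complex_norm_square[symmetric] ip_self power_mult_distrib of_real_mult)
  finally have "complex_of_real ((hnorm H (c \<odot> v))\<^sup>2) = of_real ((cmod c * hnorm H v)\<^sup>2)" .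
  then have "(hnorm H (c \<odot> v))\<^sup>2 = (cmod c * hnorm H v)\<^sup>2"
    using of_real_eq_iff by blast
  then show ?thesis using v by (simp add: power2_eq_iff_nonneg)
qed

lemma minus_eq_zero_imp_eq:
  assumes "u \<in> carrier H" "v \<in> carrier H" "u \<ominus> v = \<zero>"
  shows "u = v"
proof -
  have "(u \<ominus> v) \<oplus> v = u"
    using assms(1,2) by (simp add: M.minus_eq M.a_assoc M.l_neg)
  then show ?thesis using assms by simp
qed

text \<open>The carrier is only a subset of a type, so vectors are compared through their inner
  products; this turns every identity between vectors into one between complex numbers.\<close>

lemma vector_eqI:
  assumes "u \<in> carrier H" "v \<in> carrier H" "\<And>w. w \<in> carrier H \<Longrightarrow> ip H u w = ip H v w"
  shows "u = v"
proof -
  have "ip H (u \<ominus> v) (u \<ominus> v) = 0" using assms by (simp add: ip_diff)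
  then have "u \<ominus> v = \<zero>" using assms ip_pos[of "u \<ominus> v"] by fastforce
  then show ?thesis using assms(1,2) minus_eq_zero_imp_eq by blast
qed

text \<open>Cauchy-Schwarz for an arbitrary positive Hermitian form. It is needed for the inner product
  and for the forms \<open>\<langle>T u, v\<rangle>\<close> of positive operators \<open>T\<close>.\<close>

lemma Cauchy_Schwarz_form:
  fixes B :: "'v \<Rightarrow> 'v \<Rightarrow> complex"
  assumes u: "u \<in> carrier H" and v: "v \<in> carrier H"
    and add: "\<And>u v w. \<lbrakk>u \<in> carrier H; v \<in> carrier H; w \<in> carrier H\<rbrakk> \<Longrightarrow> B (u \<oplus> v) w = B u w + B v w"
    and smult: "\<And>c u v. \<lbrakk>u \<in> carrier H; v \<in> carrier H\<rbrakk> \<Longrightarrow> B (c \<odot> u) v = c * B u v"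
    and herm: "\<And>u v. \<lbrakk>u \<in> carrier H; v \<in> carrier H\<rbrakk> \<Longrightarrow> B v u = cnj (B u v)"
    and pos: "\<And>u. u \<in> carrier H \<Longrightarrow> 0 \<le> Re (B u u)"
  shows "(cmod (B u v))\<^sup>2 \<le> Re (B u u) * Re (B v v)"
proof -
  have key: "0 \<le> Re (B u u) - 2 * t * (cmod (B u v))\<^sup>2 + t\<^sup>2 * (cmod (B u v))\<^sup>2 * Re (B v v)" for t :: real
  proof -
    \<comment> \<open>the phase of \<open>B u v\<close> makes the mixed term real; the real number \<open>t\<close> is chosen below\<close>
    define c where "c = - of_real t * B u v"
    have "B (u \<oplus> c \<odot> v) (u \<oplus> c \<odot> v) = B u (u \<oplus> c \<odot> v) + c * B v (u \<oplus> c \<odot> v)"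
      using u v by (simp add: add smult)
    also have "B u (u \<oplus> c \<odot> v) = cnj (B u u) + cnj c * B u v"
      using herm[of "u \<oplus> c \<odot> v" u] herm[of u v] u v by (simp add: add smult)
    also have "B v (u \<oplus> c \<odot> v) = cnj (B u v) + cnj c * cnj (B v v)"
      using herm[of "u \<oplus> c \<odot> v" v] u v by (simp add: add smult)
    finally have "Re (B (u \<oplus> c \<odot> v) (u \<oplus> c \<odot> v))
        = Re (B u u) + 2 * Re (cnj c * B u v) + (cmod c)\<^sup>2 * Re (B v v)"
      by (simp add: cmod_power2) (simp add: power2_eq_square algebra_simps)
    also have "cnj c * B u v = - of_real (t * (cmod (B u v))\<^sup>2)"
      by (simp only: complex_norm_square of_real_mult) (simp add: c_def)
    also have "(cmod c)\<^sup>2 = t\<^sup>2 * (cmod (B u v))\<^sup>2"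
      by (simp add: c_def norm_mult power_mult_distrib)
    finally show ?thesis using pos[of "u \<oplus> c \<odot> v"] u v by simp
  qed
  show ?thesis
  proof (cases "Re (B v v) = 0")
    case True
    \<comment> \<open>the quadratic degenerates, and its linear part can only be bounded below if it vanishes\<close>
    have "B u v = 0"
    proof (rule ccontr)
      assume "B u v \<noteq> 0"
      then have p: "(cmod (B u v))\<^sup>2 > 0" by simp
      show False
        using key[of "(Re (B u u) + 1) / (2 * (cmod (B u v))\<^sup>2)"] p True
        by (simp add: field_simps)
    qed
    then show ?thesis using True by simp
  next
    case False
    then have p: "Re (B v v) > 0" using pos[OF v] by simp
    have "0 \<le> Re (B u u) - (cmod (B u v))\<^sup>2 / Re (B v v)"
      using key[of "1 / Re (B v v)"] p by (simp add: field_simps power2_eq_square)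
    then show ?thesis using p by (simp add: field_simps)
  qed
qed

lemma Cauchy_Schwarz:
  assumes "u \<in> carrier H" "v \<in> carrier H"
  shows "cmod (ip H u v) \<le> hnorm H u * hnorm H v"
proof -
  have "(cmod (ip H u v))\<^sup>2 \<le> Re (ip H u u) * Re (ip H v v)"
    by (rule Cauchy_Schwarz_form) (fact assms | erule (2) ip_add | erule (1) ip_smult
        | erule (1) ip_cnj | erule ip_self_nonneg)+
  then have "(cmod (ip H u v))\<^sup>2 \<le> (hnorm H u * hnorm H v)\<^sup>2"
    using assms by (simp add: Re_ip_self power_mult_distrib)
  then show ?thesis using assms by (simp add: power2_le_iff_abs_le)
qed

lemma hnorm_diff_square:
  assumes "u \<in> carrier H" "v \<in> carrier H"
  shows "(hnorm H (u \<ominus> v))\<^sup>2 = (hnorm H u)\<^sup>2 - 2 * Re (ip H u v) + (hnorm H v)\<^sup>2"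
  using assms ip_cnj[of u v] by (simp add: Re_ip_self[symmetric] ip_simps)

lemma hnorm_triangle:
  assumes "u \<in> carrier H" "v \<in> carrier H"
  shows "hnorm H (u \<oplus> v) \<le> hnorm H u + hnorm H v"
proof (rule power2_le_imp_le)
  have "(hnorm H (u \<oplus> v))\<^sup>2 = (hnorm H u)\<^sup>2 + 2 * Re (ip H u v) + (hnorm H v)\<^sup>2"
    using assms ip_cnj[of u v] by (simp add: Re_ip_self[symmetric] ip_simps)
  also have "Re (ip H u v) \<le> hnorm H u * hnorm H v"
    using Cauchy_Schwarz[OF assms] complex_Re_le_cmod order_trans by blast
  finally show "(hnorm H (u \<oplus> v))\<^sup>2 \<le> (hnorm H u + hnorm H v)\<^sup>2"
    by (simp add: power2_sum)
qed (use assms in simp)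

lemma ip_norm_le_imp_hnorm_le:
  assumes w: "w \<in> carrier H" and "0 \<le> c"
    and le: "\<And>v. \<lbrakk>v \<in> carrier H; hnorm H v \<le> 1\<rbrakk> \<Longrightarrow> cmod (ip H w v) \<le> c"
  shows "hnorm H w \<le> c"
proof (cases "hnorm H w = 0")
  case False
  then have p: "hnorm H w > 0" using w hnorm_nonneg[OF w] by linarith
  have "cmod (ip H w (of_real (1 / hnorm H w) \<odot> w)) \<le> c"
    using w p by (intro le) (auto simp: hnorm_smult norm_divide)
  then show ?thesis using w p
    by (simp add: ip_smult_right ip_self norm_mult norm_divide norm_power power2_eq_square)
qed (use \<open>0 \<le> c\<close> in simp)


section \<open>The algebra of bounded operators\<close>

lemma carrier_BH: "carrier (BH H) = bounded_ops H"
  by (simp add: BH_def)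

lemma op_closed [simp]: "A \<in> carrier (BH H) \<Longrightarrow> v \<in> carrier H \<Longrightarrow> A v \<in> carrier H"
  by (auto simp: carrier_BH bounded_ops_def)

lemma op_add: "\<lbrakk>A \<in> carrier (BH H); u \<in> carrier H; v \<in> carrier H\<rbrakk> \<Longrightarrow> A (u \<oplus> v) = A u \<oplus> A v"
  by (auto simp: carrier_BH bounded_ops_def simp del: op_closed)

lemma op_smult: "\<lbrakk>A \<in> carrier (BH H); v \<in> carrier H\<rbrakk> \<Longrightarrow> A (c \<odot> v) = c \<odot> A v"
  by (auto simp: carrier_BH bounded_ops_def simp del: op_closed)

lemma op_bounded:
  assumes "A \<in> carrier (BH H)"
  obtains M where "0 \<le> M" "\<And>v. v \<in> carrier H \<Longrightarrow> hnorm H (A v) \<le> M * hnorm H v"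
proof -
  have "\<exists>M. \<forall>v\<in>carrier H. hnorm H (A v) \<le> M * hnorm H v"
    using assms by (simp add: carrier_BH bounded_ops_def del: op_closed)
  then obtain M where M: "\<And>v. v \<in> carrier H \<Longrightarrow> hnorm H (A v) \<le> M * hnorm H v"
    by blast
  have "hnorm H (A v) \<le> max M 0 * hnorm H v" if "v \<in> carrier H" for v
    using M[OF that] mult_right_mono[of M "max M 0" "hnorm H v"] that by simp
  then show ?thesis using that[of "max M 0"] by auto
qed

lemma op_eqI:
  assumes "A \<in> carrier (BH H)" "B \<in> carrier (BH H)" "\<And>v. v \<in> carrier H \<Longrightarrow> A v = B v"
  shows "A = B"
  using assms by (intro extensionalityI[of A "carrier H" B]) (auto simp: carrier_BH bounded_ops_def PiE_def simp del: op_closed)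

lemma restrict_in_BH:
  assumes "\<And>v. v \<in> carrier H \<Longrightarrow> f v \<in> carrier H"
    and "\<And>u v. \<lbrakk>u \<in> carrier H; v \<in> carrier H\<rbrakk> \<Longrightarrow> f (u \<oplus> v) = f u \<oplus> f v"
    and "\<And>c v. v \<in> carrier H \<Longrightarrow> f (c \<odot> v) = c \<odot> f v"
    and "\<And>v. v \<in> carrier H \<Longrightarrow> hnorm H (f v) \<le> M * hnorm H v"
  shows "restrict f (carrier H) \<in> carrier (BH H)"
  using assms by (auto simp: carrier_BH bounded_ops_def PiE_def simp del: op_closed intro!: exI[of _ M])

lemma BH_one_apply [simp]: "v \<in> carrier H \<Longrightarrow> \<one>\<^bsub>BH H\<^esub> v = v"
  and BH_zero_apply [simp]: "v \<in> carrier H \<Longrightarrow> \<zero>\<^bsub>BH H\<^esub> v = \<zero>"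
  and BH_add_apply: "v \<in> carrier H \<Longrightarrow> (A \<oplus>\<^bsub>BH H\<^esub> B) v = A v \<oplus> B v"
  and BH_mult_apply: "v \<in> carrier H \<Longrightarrow> (A \<otimes>\<^bsub>BH H\<^esub> B) v = A (B v)"
  and BH_smult_apply: "v \<in> carrier H \<Longrightarrow> (c \<odot>\<^bsub>BH H\<^esub> A) v = c \<odot> A v"
  by (simp_all add: BH_def compose_def)

lemma BH_one_closed [simp, intro]: "\<one>\<^bsub>BH H\<^esub> \<in> carrier (BH H)"
  using restrict_in_BH[of "\<lambda>v. v" 1] by (simp add: BH_def)

lemma BH_zero_closed [simp, intro]: "\<zero>\<^bsub>BH H\<^esub> \<in> carrier (BH H)"
  using restrict_in_BH[of "\<lambda>v. \<zero>" 1] by (simp add: BH_def smult_r_null[of _, simplified])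

lemma BH_mult_closed [simp, intro]:
  assumes A: "A \<in> carrier (BH H)" and B: "B \<in> carrier (BH H)"
  shows "A \<otimes>\<^bsub>BH H\<^esub> B \<in> carrier (BH H)"
proof -
  obtain M where M: "0 \<le> M" "\<And>v. v \<in> carrier H \<Longrightarrow> hnorm H (A v) \<le> M * hnorm H v"
    using op_bounded[OF A] by metis
  obtain N where N: "0 \<le> N" "\<And>v. v \<in> carrier H \<Longrightarrow> hnorm H (B v) \<le> N * hnorm H v"
    using op_bounded[OF B] by metis
  have "hnorm H (A (B v)) \<le> M * N * hnorm H v" if "v \<in> carrier H" for v
    using M(2)[of "B v"] N(2)[OF that] M(1) that B
    by (metis mult.assoc mult_left_mono op_closed order_trans)
  then have "restrict (\<lambda>v. A (B v)) (carrier H) \<in> carrier (BH H)"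
    using A B by (intro restrict_in_BH) (auto simp: op_add op_smult)
  then show ?thesis by (simp add: BH_def compose_def)
qed

lemma BH_add_closed [simp, intro]:
  assumes A: "A \<in> carrier (BH H)" and B: "B \<in> carrier (BH H)"
  shows "A \<oplus>\<^bsub>BH H\<^esub> B \<in> carrier (BH H)"
proof -
  obtain M where M: "\<And>v. v \<in> carrier H \<Longrightarrow> hnorm H (A v) \<le> M * hnorm H v"
    using op_bounded[OF A] by metis
  obtain N where N: "\<And>v. v \<in> carrier H \<Longrightarrow> hnorm H (B v) \<le> N * hnorm H v"
    using op_bounded[OF B] by metis
  have "hnorm H (A v \<oplus> B v) \<le> (M + N) * hnorm H v" if "v \<in> carrier H" for v
    using hnorm_triangle[of "A v" "B v"] M[OF that] N[OF that] A B that by (auto simp: algebra_simps)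
  then have "restrict (\<lambda>v. A v \<oplus> B v) (carrier H) \<in> carrier (BH H)"
    using A B by (intro restrict_in_BH) (auto simp: op_add op_smult M.a_ac smult_r_distr)
  then show ?thesis by (simp add: BH_def)
qed

lemma BH_smult_closed [simp, intro]:
  assumes A: "A \<in> carrier (BH H)"
  shows "c \<odot>\<^bsub>BH H\<^esub> A \<in> carrier (BH H)"
proof -
  obtain M where M: "\<And>v. v \<in> carrier H \<Longrightarrow> hnorm H (A v) \<le> M * hnorm H v"
    using op_bounded[OF A] by metis
  have "hnorm H (c \<odot> A v) \<le> (cmod c * M) * hnorm H v" if "v \<in> carrier H" for v
    using M[OF that] A that by (simp add: hnorm_smult mult.assoc mult_left_mono)
  moreover have "c \<odot> (d \<odot> v) = d \<odot> (c \<odot> v)" if "v \<in> carrier H" for d v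
    using that by (simp add: smult_assoc1[of c d v, simplified, symmetric]
        smult_assoc1[of d c v, simplified, symmetric] mult.commute)
  ultimately have "restrict (\<lambda>v. c \<odot> A v) (carrier H) \<in> carrier (BH H)"
    using A by (intro restrict_in_BH) (auto simp: op_add op_smult smult_r_distr)
  then show ?thesis by (simp add: BH_def)
qed

sublocale BH: abelian_group "BH H"
proof (rule abelian_groupI)
  fix A assume A: "A \<in> carrier (BH H)"
  have "(-1) \<odot>\<^bsub>BH H\<^esub> A \<oplus>\<^bsub>BH H\<^esub> A = \<zero>\<^bsub>BH H\<^esub>"
  proof (rule op_eqI)
    show "((-1) \<odot>\<^bsub>BH H\<^esub> A \<oplus>\<^bsub>BH H\<^esub> A) v = \<zero>\<^bsub>BH H\<^esub> v" if "v \<in> carrier H" for v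
      using A that by (intro vector_eqI) (auto simp: BH_add_apply BH_smult_apply ip_simps)
  qed (use A in auto)
  then show "\<exists>B\<in>carrier (BH H). B \<oplus>\<^bsub>BH H\<^esub> A = \<zero>\<^bsub>BH H\<^esub>" using A by blast
qed (auto intro!: op_eqI simp: BH_add_apply M.a_ac)

lemma BH_minus_apply:
  assumes A: "A \<in> carrier (BH H)" and B: "B \<in> carrier (BH H)" and v: "v \<in> carrier H"
  shows "(A \<ominus>\<^bsub>BH H\<^esub> B) v = A v \<ominus> B v"
proof -
  have "((A \<ominus>\<^bsub>BH H\<^esub> B) \<oplus>\<^bsub>BH H\<^esub> B) v = A v"
    using A B by (simp add: BH.minus_eq BH.a_assoc BH.l_neg)
  moreover have "(A \<ominus>\<^bsub>BH H\<^esub> B) \<in> carrier (BH H)"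
    using A B by (rule BH.minus_closed)
  ultimately have "(A \<ominus>\<^bsub>BH H\<^esub> B) v \<oplus> B v = A v" "(A \<ominus>\<^bsub>BH H\<^esub> B) v \<in> carrier H"
    using v by (auto simp: BH_add_apply)
  then have "A v \<ominus> B v = ((A \<ominus>\<^bsub>BH H\<^esub> B) v \<oplus> B v) \<ominus> B v" "(A \<ominus>\<^bsub>BH H\<^esub> B) v \<in> carrier H"
    by simp_all
  then show ?thesis using B v
    by (simp add: M.minus_eq M.a_assoc M.r_neg)
qed

lemma ip_finsum_BH:
  assumes "finite P" "\<And>p. p \<in> P \<Longrightarrow> f p \<in> carrier (BH H)" and u: "u \<in> carrier H" "v \<in> carrier H"
  shows "ip H ((\<Oplus>\<^bsub>BH H\<^esub>p\<in>P. f p) u) v = (\<Sum>p\<in>P. ip H (f p u) v)"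
  using assms(1,2)
proof (induction P rule: finite_induct)
  case (insert p P)
  then have "(\<Oplus>\<^bsub>BH H\<^esub>p\<in>insert p P. f p) = f p \<oplus>\<^bsub>BH H\<^esub> (\<Oplus>\<^bsub>BH H\<^esub>p\<in>P. f p)"
    by (intro BH.finsum_insert) auto
  then show ?case using insert u by (auto simp: BH_add_apply ip_add)
qed (use u in simp)

lemma bdd_above_opnorm:
  assumes A: "A \<in> carrier (BH H)"
  shows "bdd_above ((\<lambda>v. hnorm H (A v)) ` {v \<in> carrier H. hnorm H v \<le> 1})"
proof -
  obtain M where M: "0 \<le> M" "\<And>v. v \<in> carrier H \<Longrightarrow> hnorm H (A v) \<le> M * hnorm H v"
    using op_bounded[OF A] by metis
  have "hnorm H (A u) \<le> M" if "u \<in> carrier H" "hnorm H u \<le> 1" for u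
    using M(2)[OF that(1)] mult_left_mono[OF that(2) M(1)] by simp
  then show ?thesis by (auto intro!: bdd_aboveI)
qed

lemma hnorm_le_opnorm:
  assumes A: "A \<in> carrier (BH H)" and v: "v \<in> carrier H"
  shows "hnorm H (A v) \<le> opnorm H A * hnorm H v"
proof (cases "hnorm H v = 0")
  case True
  then have "v = \<zero>" using v by (simp add: hnorm_eq_0)
  then have "A v = 0 \<odot> A v" using op_smult[OF A v, of 0] v A by (simp add: smult_l_null[simplified])
  then show ?thesis using True hnorm_smult[of "A v" 0] A v by simp
next
  case False
  then have p: "hnorm H v > 0" using hnorm_nonneg[OF v] by linarith
  define w where "w = of_real (1 / hnorm H v) \<odot> v"
  have "w \<in> {v \<in> carrier H. hnorm H v \<le> 1}"
    using v p by (auto simp: w_def hnorm_smult norm_divide)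
  then have "hnorm H (A w) \<le> opnorm H A"
    unfolding opnorm_def using bdd_above_opnorm[OF A] by (rule cSUP_upper)
  then show ?thesis using A v p by (simp add: w_def op_smult hnorm_smult norm_divide field_simps)
qed

lemma opnorm_leI:
  assumes "\<And>v. \<lbrakk>v \<in> carrier H; hnorm H v \<le> 1\<rbrakk> \<Longrightarrow> hnorm H (A v) \<le> c"
  shows "opnorm H A \<le> c"
  unfolding opnorm_def
proof (rule cSUP_least)
  have "\<zero> \<in> {v \<in> carrier H. hnorm H v \<le> 1}" by simp
  then show "{v \<in> carrier H. hnorm H v \<le> 1} \<noteq> {}" by blast
qed (use assms in auto)

lemma opnorm_nonneg:
  assumes A: "A \<in> carrier (BH H)"
  shows "0 \<le> opnorm H A"
proof -
  have "hnorm H (A \<zero>) \<le> opnorm H A"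
    unfolding opnorm_def by (rule cSUP_upper[OF _ bdd_above_opnorm[OF A]]) simp
  then show ?thesis using hnorm_nonneg[OF op_closed[OF A M.zero_closed]] by linarith
qed

lemma norm_ip_le_opnorm:
  assumes "A \<in> carrier (BH H)" "u \<in> carrier H" "v \<in> carrier H"
  shows "cmod (ip H (A u) v) \<le> opnorm H A * hnorm H u * hnorm H v"
  using Cauchy_Schwarz[of "A u" v] hnorm_le_opnorm[of A u] assms
  by (meson hnorm_nonneg mult_right_mono op_closed order_trans)


section \<open>Adjoints and invertibility of positive operators\<close>

text \<open>The Riesz representation theorem for the inner product \<open>\<langle>T u, v\<rangle>\<close>, which is equivalent to the
  given one. The representing vector minimises \<open>J v = \<langle>T v, v\<rangle> - 2 Re (\<phi> v)\<close>: by the parallelogram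
  law (\<open>J\<close> at a midpoint) minimising sequences are Cauchy, and the first variation of \<open>J\<close> at the
  limit is \<open>\<langle>h, T l\<rangle> - \<phi> h\<close>. With \<open>T = 1\<close> this yields adjoints, with \<open>\<phi> = \<langle>\<cdot>, w\<rangle>\<close> inverses.\<close>

lemma Riesz_representation_coercive:
  assumes T: "T \<in> carrier (BH H)"
    and herm: "\<And>u v. \<lbrakk>u \<in> carrier H; v \<in> carrier H\<rbrakk> \<Longrightarrow> ip H (T u) v = ip H u (T v)"
    and "0 < \<delta>" and coercive: "\<And>v. v \<in> carrier H \<Longrightarrow> \<delta> * (hnorm H v)\<^sup>2 \<le> Re (ip H (T v) v)"
    and add: "\<And>u v. \<lbrakk>u \<in> carrier H; v \<in> carrier H\<rbrakk> \<Longrightarrow> \<phi> (u \<oplus> v) = \<phi> u + \<phi> v"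
    and smult: "\<And>c v. v \<in> carrier H \<Longrightarrow> \<phi> (c \<odot> v) = c * \<phi> v"
    and bounded: "\<And>v. v \<in> carrier H \<Longrightarrow> cmod (\<phi> v) \<le> K * hnorm H v"
  shows "\<exists>w\<in>carrier H. \<forall>h\<in>carrier H. \<phi> h = ip H h (T w)"
proof -
  define Q where "Q v = Re (ip H (T v) v)" for v
  define J where "J v = Q v - 2 * Re (\<phi> v)" for v
  define E where "E s h = ip H h (T s) - \<phi> h" for s h
  have Q_nonneg: "0 \<le> Q v" if "v \<in> carrier H" for v
    using coercive[OF that] \<open>0 < \<delta>\<close> unfolding Q_def
    by (meson order_trans mult_nonneg_nonneg less_imp_le zero_le_power2)
  have variation: "J (s \<oplus> c \<odot> h) = J s + 2 * Re (c * E s h) + (cmod c)\<^sup>2 * Q h"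
    if s: "s \<in> carrier H" and h: "h \<in> carrier H" for s h c
  proof -
    have "ip H (T (s \<oplus> c \<odot> h)) (s \<oplus> c \<odot> h)
        = ip H (T s) s + (cnj c * ip H (T s) h + c * ip H (T h) s) + c * cnj c * ip H (T h) h"
      using s h T by (simp add: op_add op_smult ip_simps algebra_simps)
    also have "ip H (T s) h = cnj (ip H h (T s))"
      using s h T by (metis ip_cnj op_closed)
    also have "ip H (T h) s = ip H h (T s)"
      using s h by (simp add: herm)
    also have "c * cnj c * ip H (T h) h = of_real ((cmod c)\<^sup>2) * ip H (T h) h"
      by (simp only: complex_norm_square)
    finally have "Q (s \<oplus> c \<odot> h) = Q s + 2 * Re (c * ip H h (T s)) + (cmod c)\<^sup>2 * Q h"
      by (simp add: Q_def del: of_real_power)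
    then show ?thesis using s h by (simp add: J_def E_def add smult algebra_simps)
  qed
  have J_below: "- (K\<^sup>2 / \<delta>) \<le> J v" if v: "v \<in> carrier H" for v
  proof -
    have "Re (\<phi> v) \<le> K * hnorm H v"
      using bounded[OF v] complex_Re_le_cmod order_trans by blast
    then have "\<delta> * (hnorm H v)\<^sup>2 - 2 * (K * hnorm H v) \<le> J v"
      using coercive[OF v] by (simp add: J_def Q_def)
    moreover have "0 \<le> (\<delta> * hnorm H v - K)\<^sup>2 / \<delta>"
      using \<open>0 < \<delta>\<close> by simp
    then have "- (K\<^sup>2 / \<delta>) \<le> \<delta> * (hnorm H v)\<^sup>2 - 2 * (K * hnorm H v)"
      using \<open>0 < \<delta>\<close> by (simp add: power2_eq_square field_simps)
    ultimately show ?thesis by linarith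
  qed
  define m where "m = (INF v\<in>carrier H. J v)"
  have bdd: "bdd_below (J ` carrier H)"
    using J_below by (auto intro!: bdd_belowI)
  have m_le: "m \<le> J v" if "v \<in> carrier H" for v
    unfolding m_def using bdd that by (rule cINF_lower)
  have "\<exists>v\<in>carrier H. J v < m + 1 / (real n + 1)" for n
    using cINF_less_iff[OF _ bdd, of "m + 1 / (real n + 1)"] M.zero_closed m_def
    by (smt (verit) divide_pos_pos empty_iff of_nat_0_le_iff)
  then obtain s where s: "\<And>n. s n \<in> carrier H" and Js: "\<And>n. J (s n) < m + 1 / (real n + 1)"
    by metis
  \<comment> \<open>comparing \<open>J\<close> at \<open>u\<close> and \<open>v\<close> with its value at their midpoint, which is at least \<open>m\<close>\<close>
  have dist: "\<delta> * (hnorm H (v \<ominus> u))\<^sup>2 \<le> 2 * (J u + J v - 2 * m)"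
    if u: "u \<in> carrier H" and v: "v \<in> carrier H" for u v
  proof -
    have "u \<oplus> 1 \<odot> (v \<ominus> u) = v"
      using u v by (intro vector_eqI) (auto simp: ip_simps)
    then have 1: "J v = J u + 2 * Re (E u (v \<ominus> u)) + Q (v \<ominus> u)"
      using variation[of u "v \<ominus> u" 1] u v by simp
    have "m \<le> J (u \<oplus> (1/2) \<odot> (v \<ominus> u))"
      using u v by (intro m_le) auto
    also have "\<dots> = J u + Re (E u (v \<ominus> u)) + Q (v \<ominus> u) / 4"
      using u v by (simp add: variation norm_divide power_divide)
    finally show ?thesis
      using 1 coercive[of "v \<ominus> u"] u v unfolding Q_def by simp
  qed
  have "\<exists>l\<in>carrier H. (\<lambda>n. hnorm H (s n \<ominus> l)) \<longlonglongrightarrow> 0"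
  proof (rule complete)
    fix e :: real assume "0 < e"
    then have "0 < \<delta> * e\<^sup>2 / 4" using \<open>0 < \<delta>\<close> by simp
    then obtain N where N: "1 / (real N + 1) < \<delta> * e\<^sup>2 / 4"
      using reals_Archimedean by (metis add.commute inverse_eq_divide of_nat_Suc)
    have "hnorm H (s i \<ominus> s j) < e" if "N \<le> i" "N \<le> j" for i j
    proof -
      have "J (s k) < m + \<delta> * e\<^sup>2 / 4" if "N \<le> k" for k
      proof -
        have "1 / (real k + 1) \<le> 1 / (real N + 1)" using that by (auto simp: frac_le)
        then show ?thesis using Js[of k] N by linarith
      qed
      from this[OF \<open>N \<le> i\<close>] this[OF \<open>N \<le> j\<close>]
      have "\<delta> * (hnorm H (s i \<ominus> s j))\<^sup>2 < \<delta> * e\<^sup>2"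
        using dist[OF s s, of i j] by (simp add: field_simps)
      then have "(hnorm H (s i \<ominus> s j))\<^sup>2 < e\<^sup>2" using \<open>0 < \<delta>\<close> by simp
      then show ?thesis using \<open>0 < e\<close> by (meson power2_less_imp_less less_imp_le)
    qed
    then show "\<exists>N. \<forall>m\<ge>N. \<forall>n\<ge>N. hnorm H (s m \<ominus> s n) < e" by blast
  qed (use s in auto)
  then obtain l where l: "l \<in> carrier H" and lim: "(\<lambda>n. hnorm H (s n \<ominus> l)) \<longlonglongrightarrow> 0"
    by blast
  have "E l h = 0" if h: "h \<in> carrier H" for h
  proof (rule ccontr)
    assume nz: "E l h \<noteq> 0"
    have "cmod (E (s n) h - E l h) \<le> hnorm H (T h) * hnorm H (s n \<ominus> l)" for n
    proof -
      have "E (s n) h - E l h = ip H (T h) (s n \<ominus> l)"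
        using s[of n] l h T by (simp add: E_def herm ip_diff_right)
      then show ?thesis using Cauchy_Schwarz[of "T h" "s n \<ominus> l"] s[of n] l h T by simp
    qed
    moreover have "(\<lambda>n. hnorm H (T h) * hnorm H (s n \<ominus> l)) \<longlonglongrightarrow> 0"
      using tendsto_mult_left[OF lim, of "hnorm H (T h)"] by simp
    ultimately have "(\<lambda>n. E (s n) h - E l h) \<longlonglongrightarrow> 0"
      by (rule Lim_null_comparison[OF always_eventually[OF allI]])
    then have E_lim: "(\<lambda>n. E (s n) h) \<longlonglongrightarrow> E l h"
      by (rule LIM_zero_cancel)
    have stationary: "0 \<le> 2 * Re (c * E l h) + (cmod c)\<^sup>2 * Q h" for c
    proof (rule LIMSEQ_le)
      show "(\<lambda>n. - (1 / (real n + 1))) \<longlonglongrightarrow> 0"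
        using tendsto_minus[OF LIMSEQ_inverse_real_of_nat] by (simp add: inverse_eq_divide add.commute)
      show "(\<lambda>n. 2 * Re (c * E (s n) h) + (cmod c)\<^sup>2 * Q h) \<longlonglongrightarrow> 2 * Re (c * E l h) + (cmod c)\<^sup>2 * Q h"
        by (intro tendsto_intros E_lim)
      have "- (1 / (real n + 1)) \<le> 2 * Re (c * E (s n) h) + (cmod c)\<^sup>2 * Q h" for n
        using m_le[of "s n \<oplus> c \<odot> h"] Js[of n] s[of n] h by (simp add: variation)
      then show "\<exists>N. \<forall>n\<ge>N. - (1 / (real n + 1)) \<le> 2 * Re (c * E (s n) h) + (cmod c)\<^sup>2 * Q h"
        by blast
    qed
    \<comment> \<open>a short step against the gradient, \<open>c = - \<epsilon> cnj (E l h)\<close>, would decrease \<open>J\<close> to first order\<close>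
    define \<epsilon> where "\<epsilon> = 1 / (Q h + 1)"
    have \<epsilon>: "0 < \<epsilon>" "\<epsilon> * Q h < 2" using Q_nonneg[OF h] by (auto simp: \<epsilon>_def field_simps)
    have "of_real (- \<epsilon>) * cnj (E l h) * E l h = of_real (- \<epsilon> * (cmod (E l h))\<^sup>2)"
      by (simp only: complex_norm_square of_real_mult mult.assoc mult.commute[of "cnj (E l h)"])
    then have "0 \<le> 2 * (- \<epsilon> * (cmod (E l h))\<^sup>2) + (\<epsilon> * cmod (E l h))\<^sup>2 * Q h"
      using stationary[of "of_real (- \<epsilon>) * cnj (E l h)"] \<epsilon>
      by (simp add: norm_mult del: of_real_minus of_real_mult)
    also have "\<dots> = (\<epsilon> * Q h - 2) * (\<epsilon> * (cmod (E l h))\<^sup>2)"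
      by (simp add: power2_eq_square algebra_simps)
    also have "\<dots> < 0" using \<epsilon> nz by (simp add: mult_neg_pos)
    finally show False by simp
  qed
  then show ?thesis using l by (auto simp: E_def intro!: bexI[of _ l])
qed

lemma adjoint_exists:
  assumes A: "A \<in> carrier (BH H)"
  shows "\<exists>B\<in>carrier (BH H). \<forall>v\<in>carrier H. \<forall>w\<in>carrier H. ip H (A v) w = ip H v (B w)"
proof -
  obtain M where M: "0 \<le> M" "\<And>v. v \<in> carrier H \<Longrightarrow> hnorm H (A v) \<le> M * hnorm H v"
    using op_bounded[OF A] by metis
  have bound: "cmod (ip H (A v) w) \<le> M * hnorm H w * hnorm H v"
    if "v \<in> carrier H" "w \<in> carrier H" for v w
    using Cauchy_Schwarz[of "A v" w] mult_right_mono[OF M(2)[OF that(1)], of "hnorm H w"] A that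
    by (simp add: mult_ac)
  have "\<exists>u\<in>carrier H. \<forall>v\<in>carrier H. ip H (A v) w = ip H v (\<one>\<^bsub>BH H\<^esub> u)" if w: "w \<in> carrier H" for w
    using A w bound
    by (intro Riesz_representation_coercive[where \<delta> = 1 and K = "M * hnorm H w"])
       (auto simp: op_add op_smult ip_simps Re_ip_self)
  then obtain B where B: "\<And>w. w \<in> carrier H \<Longrightarrow> B w \<in> carrier H"
    "\<And>v w. \<lbrakk>v \<in> carrier H; w \<in> carrier H\<rbrakk> \<Longrightarrow> ip H (A v) w = ip H v (B w)"
    by (metis BH_one_apply)
  have sym: "ip H (B w) v = cnj (ip H (A v) w)" if "v \<in> carrier H" "w \<in> carrier H" for v w
    using B that ip_cnj by metis
  have "restrict B (carrier H) \<in> carrier (BH H)"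
  proof (rule restrict_in_BH)
    show "B (u \<oplus> v) = B u \<oplus> B v" if "u \<in> carrier H" "v \<in> carrier H" for u v
      using that A B(1) by (intro vector_eqI) (auto simp: sym ip_simps)
    show "B (c \<odot> v) = c \<odot> B v" if "v \<in> carrier H" for c v
      using that A B(1) by (intro vector_eqI) (auto simp: sym ip_simps)
    show "hnorm H (B w) \<le> M * hnorm H w" if w: "w \<in> carrier H" for w
    proof (rule ip_norm_le_imp_hnorm_le)
      show "cmod (ip H (B w) v) \<le> M * hnorm H w" if v: "v \<in> carrier H" "hnorm H v \<le> 1" for v
        using bound[OF v(1) w] mult_left_mono[OF v(2), of "M * hnorm H w"] M(1) v w
        by (simp add: sym)
    qed (use B w M in auto)
  qed (use B in auto)
  then show ?thesis using B(2) by (auto intro!: bexI[of _ "restrict B (carrier H)"])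
qed

lemma
  assumes A: "A \<in> carrier (BH H)"
  shows adj_closed [simp, intro]: "adj H A \<in> carrier (BH H)"
    and ip_adj: "\<lbrakk>v \<in> carrier H; w \<in> carrier H\<rbrakk> \<Longrightarrow> ip H (A v) w = ip H v (adj H A w)"
proof -
  have uniq: "B = C" if B: "B \<in> carrier (BH H)" "\<forall>v\<in>carrier H. \<forall>w\<in>carrier H. ip H (A v) w = ip H v (B w)"
    and C: "C \<in> carrier (BH H)" "\<forall>v\<in>carrier H. \<forall>w\<in>carrier H. ip H (A v) w = ip H v (C w)" for B C
    using B C by (intro op_eqI vector_eqI) (auto, metis ip_cnj op_closed)
  \<comment> \<open>\<open>adj\<close> is a definite description, meaningful only because the adjoint exists and is unique\<close>
  have "\<exists>!B. B \<in> carrier (BH H) \<and> (\<forall>v\<in>carrier H. \<forall>w\<in>carrier H. ip H (A v) w = ip H v (B w))"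
    using adjoint_exists[OF A] uniq by blast
  from theI'[OF this] have *: "adj H A \<in> carrier (BH H) \<and>
      (\<forall>v\<in>carrier H. \<forall>w\<in>carrier H. ip H (A v) w = ip H v (adj H A w))"
    unfolding adj_def .
  show "adj H A \<in> carrier (BH H)" using * by blast
  show "\<lbrakk>v \<in> carrier H; w \<in> carrier H\<rbrakk> \<Longrightarrow> ip H (A v) w = ip H v (adj H A w)" using * by blast
qed

lemma ip_adj_left:
  assumes "A \<in> carrier (BH H)" "v \<in> carrier H" "w \<in> carrier H"
  shows "ip H (adj H A v) w = ip H v (A w)"
  using assms by (metis ip_adj ip_cnj op_closed adj_closed)

lemma adj_smult:
  assumes A: "A \<in> carrier (BH H)" and v: "v \<in> carrier H"
  shows "adj H (c \<odot>\<^bsub>BH H\<^esub> A) v = cnj c \<odot> adj H A v"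
  using assms by (intro vector_eqI) (auto simp: ip_adj_left BH_smult_apply ip_simps)

lemma adj_commute:
  assumes A: "A \<in> carrier (BH H)" and B: "B \<in> carrier (BH H)"
    and AB: "A \<otimes>\<^bsub>BH H\<^esub> B = B \<otimes>\<^bsub>BH H\<^esub> A" and v: "v \<in> carrier H"
  shows "adj H A (adj H B v) = adj H B (adj H A v)"
proof (rule vector_eqI)
  fix w assume w: "w \<in> carrier H"
  have "B (A w) = A (B w)" using AB w by (metis BH_mult_apply)
  then show "ip H (adj H A (adj H B v)) w = ip H (adj H B (adj H A v)) w"
    using A B v w by (simp add: ip_adj_left)
qed (use A B v in auto)

text \<open>Polarisation: testing \<open>u + v\<close> controls the imaginary part of \<open>\<langle>T u, v\<rangle> + \<langle>T v, u\<rangle>\<close>, and testing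
  \<open>u + \<i> v\<close> the real part of the difference.\<close>

lemma hermitian_if_diagonal_real:
  assumes T: "T \<in> carrier (BH H)" and real: "\<And>v. v \<in> carrier H \<Longrightarrow> ip H (T v) v \<in> \<real>"
    and u: "u \<in> carrier H" and v: "v \<in> carrier H"
  shows "ip H (T u) v = ip H u (T v)"
proof -
  define a b where "a = ip H (T u) v" and "b = ip H (T v) u"
  have im: "Im (ip H (T u) u) = 0" "Im (ip H (T v) v) = 0"
    using real u v by (auto simp: complex_is_Real_iff)
  have "ip H (T (u \<oplus> v)) (u \<oplus> v) = ip H (T u) u + ip H (T v) v + (a + b)"
    using T u v by (simp add: op_add ip_simps a_def b_def)
  then have "Im (a + b) = 0"
    using real[of "u \<oplus> v"] im u v by (simp add: complex_is_Real_iff)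
  moreover have "ip H (T (u \<oplus> \<i> \<odot> v)) (u \<oplus> \<i> \<odot> v) = ip H (T u) u + ip H (T v) v + \<i> * (b - a)"
    using T u v by (simp add: op_add op_smult ip_simps a_def b_def algebra_simps)
  then have "Re (b - a) = 0"
    using real[of "u \<oplus> \<i> \<odot> v"] im u v by (simp add: complex_is_Real_iff)
  ultimately have "a = cnj b" by (simp add: complex_eq_iff)
  then show ?thesis using T u v by (metis a_def b_def ip_cnj op_closed)
qed

lemma coercive_imp_unit:
  assumes T: "T \<in> carrier (BH H)"
    and herm: "\<And>u v. \<lbrakk>u \<in> carrier H; v \<in> carrier H\<rbrakk> \<Longrightarrow> ip H (T u) v = ip H u (T v)"
    and "0 < \<delta>" and coercive: "\<And>v. v \<in> carrier H \<Longrightarrow> \<delta> * (hnorm H v)\<^sup>2 \<le> Re (ip H (T v) v)"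
  shows "T \<in> Units (BH H)"
proof -
  have lower: "\<delta> * hnorm H v \<le> hnorm H (T v)" if v: "v \<in> carrier H" for v
  proof (cases "hnorm H v = 0")
    case False
    then have p: "0 < hnorm H v" using hnorm_nonneg[OF v] by linarith
    have "\<delta> * (hnorm H v)\<^sup>2 \<le> hnorm H (T v) * hnorm H v"
      using coercive[OF v] Cauchy_Schwarz[of "T v" v] complex_Re_le_cmod[of "ip H (T v) v"] T v
      by (meson op_closed order_trans)
    then show ?thesis using p by (simp add: power2_eq_square)
  qed (use T v in simp)
  have inj: "u = v" if u: "u \<in> carrier H" and v: "v \<in> carrier H" and eq: "T u = T v" for u v
  proof -
    have "T (u \<ominus> v) = \<zero>"
    proof (rule vector_eqI)
      fix w assume w: "w \<in> carrier H"
      have "ip H (T (u \<ominus> v)) w = ip H (T u) w - ip H (T v) w"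
        using u v w T by (simp add: herm ip_diff)
      then show "ip H (T (u \<ominus> v)) w = ip H \<zero> w" using eq w by simp
    qed (use T u v in auto)
    then have "hnorm H (u \<ominus> v) \<le> 0" "0 \<le> hnorm H (u \<ominus> v)"
      using lower[of "u \<ominus> v"] u v \<open>0 < \<delta>\<close> by (auto simp: mult_le_0_iff)
    then have "u \<ominus> v = \<zero>" using u v hnorm_eq_0[of "u \<ominus> v"] by simp
    then show ?thesis using u v minus_eq_zero_imp_eq by blast
  qed
  have "\<exists>v\<in>carrier H. \<forall>h\<in>carrier H. ip H h w = ip H h (T v)" if w: "w \<in> carrier H" for w
    using T herm \<open>0 < \<delta>\<close> coercive w Cauchy_Schwarz[OF _ w]
    by (intro Riesz_representation_coercive[where \<delta> = \<delta> and K = "hnorm H w"])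
       (auto simp: ip_simps mult.commute)
  then obtain S where S: "\<And>w. w \<in> carrier H \<Longrightarrow> S w \<in> carrier H"
    and TS': "\<And>h w. \<lbrakk>w \<in> carrier H; h \<in> carrier H\<rbrakk> \<Longrightarrow> ip H h w = ip H h (T (S w))"
    by metis
  have TS: "T (S w) = w" if w: "w \<in> carrier H" for w
  proof (rule vector_eqI)
    show "ip H (T (S w)) h = ip H w h" if h: "h \<in> carrier H" for h
      using TS'[OF w h] ip_cnj[OF h w] ip_cnj[of h "T (S w)"] S[OF w] T h by simp
  qed (use S T w in auto)
  have ST: "S (T v) = v" if "v \<in> carrier H" for v
    using that T S TS inj by simp
  have R: "restrict S (carrier H) \<in> carrier (BH H)"
  proof (rule restrict_in_BH)
    show "S (u \<oplus> v) = S u \<oplus> S v" if "u \<in> carrier H" "v \<in> carrier H" for u v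
      by (rule inj) (use that S T in \<open>auto simp: TS op_add\<close>)
    show "S (c \<odot> v) = c \<odot> S v" if "v \<in> carrier H" for c v
      by (rule inj) (use that S T in \<open>auto simp: TS op_smult\<close>)
    show "hnorm H (S w) \<le> (1 / \<delta>) * hnorm H w" if "w \<in> carrier H" for w
      using lower[OF S[OF that]] that \<open>0 < \<delta>\<close> by (simp add: TS field_simps)
  qed (use S in auto)
  have "restrict S (carrier H) \<otimes>\<^bsub>BH H\<^esub> T = \<one>\<^bsub>BH H\<^esub>"
    using ST op_closed[OF T]
    by (intro op_eqI[OF BH_mult_closed[OF R T] BH_one_closed])
       (simp only: BH_mult_apply BH_one_apply restrict_apply')
  moreover have "T \<otimes>\<^bsub>BH H\<^esub> restrict S (carrier H) = \<one>\<^bsub>BH H\<^esub>"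
    using TS
    by (intro op_eqI[OF BH_mult_closed[OF T R] BH_one_closed])
       (simp only: BH_mult_apply BH_one_apply restrict_apply')
  ultimately
  show ?thesis using R T by (auto simp: Units_def)
qed

text \<open>Conversely a positive invertible \<open>T\<close> is bounded below: Cauchy-Schwarz for the form
  \<open>\<langle>T u, v\<rangle>\<close> gives \<open>\<parallel>T v\<parallel>\<^sup>2 \<le> \<parallel>T\<parallel> \<langle>T v, v\<rangle>\<close>, and \<open>\<parallel>v\<parallel> \<le> \<parallel>T\<^sup>-\<^sup>1\<parallel> \<parallel>T v\<parallel>\<close>.\<close>

lemma positive_unit_imp_coercive:
  assumes pos: "positive_op H T" and unit: "T \<in> Units (BH H)"
  obtains \<delta> where "0 < \<delta>" "\<And>v. v \<in> carrier H \<Longrightarrow> \<delta> * (hnorm H v)\<^sup>2 \<le> Re (ip H (T v) v)"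
proof -
  have T: "T \<in> carrier (BH H)" using pos by (simp add: positive_op_def)
  have nn: "ip H (T v) v \<in> \<real>\<^sub>\<ge>\<^sub>0" if "v \<in> carrier H" for v
    using pos that by (simp add: positive_op_def)
  have herm: "ip H (T u) v = ip H u (T v)" if "u \<in> carrier H" "v \<in> carrier H" for u v
    using nn that T
    by (intro hermitian_if_diagonal_real) (auto simp: complex_is_Real_iff complex_nonneg_Reals_iff)
  obtain S where S: "S \<in> carrier (BH H)" and ST: "S \<otimes>\<^bsub>BH H\<^esub> T = \<one>\<^bsub>BH H\<^esub>"
    using unit by (auto simp: Units_def)
  obtain M where M: "0 \<le> M" "\<And>v. v \<in> carrier H \<Longrightarrow> hnorm H (T v) \<le> M * hnorm H v"
    using op_bounded[OF T] by metis
  obtain N where N: "0 \<le> N" "\<And>v. v \<in> carrier H \<Longrightarrow> hnorm H (S v) \<le> N * hnorm H v"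
    using op_bounded[OF S] by metis
  \<comment> \<open>both bounds may be \<open>0\<close> on the zero space, hence the summands \<open>1\<close>\<close>
  define \<delta> where "\<delta> = 1 / ((N + 1)\<^sup>2 * (M + 1))"
  have "0 < \<delta>" using M(1) N(1) by (simp add: \<delta>_def)
  moreover have "\<delta> * (hnorm H v)\<^sup>2 \<le> Re (ip H (T v) v)" if v: "v \<in> carrier H" for v
  proof -
    define q where "q = Re (ip H (T v) v)"
    define t where "t = hnorm H (T v)"
    have q: "0 \<le> q" using nn[OF v] by (simp add: q_def complex_nonneg_Reals_iff)
    have t: "0 \<le> t" using v T by (simp add: t_def)
    have "S (T v) = v" using ST v by (metis BH_mult_apply BH_one_apply)
    then have "hnorm H v \<le> N * t" using N(2)[of "T v"] v T by (simp add: t_def)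
    also have "\<dots> \<le> (N + 1) * t" using t by (simp add: algebra_simps)
    finally have 1: "(hnorm H v)\<^sup>2 \<le> (N + 1)\<^sup>2 * t\<^sup>2"
      using v by (metis hnorm_nonneg power_mono power_mult_distrib)
    have "(cmod (ip H (T v) (T v)))\<^sup>2 \<le> q * Re (ip H (T (T v)) (T v))"
      unfolding q_def
    proof (rule Cauchy_Schwarz_form)
      show "ip H (T w) u = cnj (ip H (T u) w)" if "u \<in> carrier H" "w \<in> carrier H" for u w
        using that T herm by (metis ip_cnj op_closed)
      show "0 \<le> Re (ip H (T u) u)" if "u \<in> carrier H" for u
        using nn[OF that] by (simp add: complex_nonneg_Reals_iff)
    qed (use v T in \<open>auto simp: op_add op_smult ip_simps\<close>)
    moreover have "cmod (ip H (T v) (T v)) = t\<^sup>2"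
      using v T by (simp add: ip_self t_def norm_power)
    moreover have "Re (ip H (T (T v)) (T v)) \<le> (M + 1) * t\<^sup>2"
    proof -
      have "Re (ip H (T (T v)) (T v)) \<le> hnorm H (T (T v)) * t"
        using Cauchy_Schwarz[of "T (T v)" "T v"] complex_Re_le_cmod v T unfolding t_def
        by (meson op_closed order_trans)
      also have "\<dots> \<le> (M * t) * t"
        using M(2)[of "T v"] v T t by (intro mult_right_mono) (auto simp: t_def)
      also have "\<dots> \<le> (M + 1) * t\<^sup>2"
        using t by (simp add: power2_eq_square algebra_simps)
      finally show ?thesis .
    qed
    ultimately have "t\<^sup>2 * t\<^sup>2 \<le> q * ((M + 1) * t\<^sup>2)"
      using q by (metis mult_left_mono order_trans power2_eq_square)
    then have "t\<^sup>2 \<le> q * (M + 1)"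
    proof (cases "t = 0")
      case False
      then have "0 < t\<^sup>2" by simp
      moreover have "t\<^sup>2 * t\<^sup>2 \<le> (q * (M + 1)) * t\<^sup>2"
        using \<open>t\<^sup>2 * t\<^sup>2 \<le> q * ((M + 1) * t\<^sup>2)\<close> by (simp only: mult.assoc)
      ultimately show ?thesis by (rule mult_right_le_imp_le[rotated])
    qed (use q M(1) in simp)
    then have "(hnorm H v)\<^sup>2 \<le> (N + 1)\<^sup>2 * (q * (M + 1))"
      using 1 mult_left_mono[of "t\<^sup>2" "q * (M + 1)" "(N + 1)\<^sup>2"] by simp
    moreover have "0 < (N + 1)\<^sup>2 * (M + 1)" using M(1) N(1) by simp
    ultimately show ?thesis unfolding \<delta>_def q_def[symmetric]
      by (simp add: pos_divide_le_eq mult_ac)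
  qed
  ultimately show ?thesis using that by blast
qed

end

section \<open>Dilating points of the polyball\<close>

definition defect_step ::
    "'v hilbert \<Rightarrow> real \<Rightarrow> ('v \<Rightarrow> 'v) list \<Rightarrow> ('v \<Rightarrow> real) \<Rightarrow> 'v \<Rightarrow> real" where
  "defect_step H t x q u = q u - t * (\<Sum>j<length x. q (adj H (x ! j) u))"

text \<open>The quadratic form of \<open>(id - t\<^sub>1 \<Phi>\<^sub>1) \<circ> \<dots> \<circ> (id - t\<^sub>k \<Phi>\<^sub>k)\<close> applied to the identity operator.
  Giving each block its own weight \<open>t\<^sub>i\<close> allows the weights to be changed one at a time.\<close>

definition defect_form ::
    "'v hilbert \<Rightarrow> (real \<times> ('v \<Rightarrow> 'v) list) list \<Rightarrow> 'v \<Rightarrow> real" where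
  "defect_form H ps = foldr (\<lambda>(t, x). defect_step H t x) ps (\<lambda>u. (hnorm H u)\<^sup>2)"

definition scale_tuple ::
    "'v hilbert \<Rightarrow> complex \<Rightarrow> ('v \<Rightarrow> 'v) list list \<Rightarrow> ('v \<Rightarrow> 'v) list list" where
  "scale_tuple H z X = map (map (\<lambda>A. z \<odot>\<^bsub>BH H\<^esub> A)) X"

definition commuting_blocks :: "'v hilbert \<Rightarrow> ('v \<Rightarrow> 'v) list list \<Rightarrow> bool" where
  "commuting_blocks H X \<longleftrightarrow> (\<forall>s<length X. \<forall>t<length X. s \<noteq> t \<longrightarrow>
     (\<forall>A\<in>set (X ! s). \<forall>B\<in>set (X ! t). A \<otimes>\<^bsub>BH H\<^esub> B = B \<otimes>\<^bsub>BH H\<^esub> A))"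

lemma defect_form_Nil [simp]: "defect_form H [] = (\<lambda>u. (hnorm H u)\<^sup>2)"
  and defect_form_Cons [simp]:
    "defect_form H ((t, x) # ps) = defect_step H t x (defect_form H ps)"
  by (simp_all add: defect_form_def)

context hilbert_space
begin

lemma nth_op:
  "\<lbrakk>set x \<subseteq> carrier (BH H); j < length x\<rbrakk> \<Longrightarrow> x ! j \<in> carrier (BH H)"
  by (meson nth_mem subsetD)

lemma adj_nth_in:
  "\<lbrakk>set x \<subseteq> carrier (BH H); j < length x; u \<in> carrier H\<rbrakk> \<Longrightarrow> adj H (x ! j) u \<in> carrier H"
  using nth_op by simp

lemma Phi_closed:
  assumes x: "set x \<subseteq> carrier (BH H)" and Y: "Y \<in> carrier (BH H)"
  shows "Phi H x Y \<in> carrier (BH H)"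
  unfolding Phi_def using nth_op[OF x] Y by (intro BH.finsum_closed) auto

lemma ip_Phi:
  assumes x: "set x \<subseteq> carrier (BH H)" and Y: "Y \<in> carrier (BH H)"
    and u: "u \<in> carrier H" and v: "v \<in> carrier H"
  shows "ip H (Phi H x Y u) v = (\<Sum>j<length x. ip H (Y (adj H (x ! j) u)) (adj H (x ! j) v))"
  unfolding Phi_def
proof (subst ip_finsum_BH)
  show "(\<Sum>j<length x. ip H ((x ! j \<otimes>\<^bsub>BH H\<^esub> Y \<otimes>\<^bsub>BH H\<^esub> adj H (x ! j)) u) v)
      = (\<Sum>j<length x. ip H (Y (adj H (x ! j) u)) (adj H (x ! j) v))"
  proof (intro sum.cong refl)
    fix j assume "j \<in> {..<length x}"
    then have xj: "x ! j \<in> carrier (BH H)" using nth_op[OF x] by simp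
    have "adj H (x ! j) u \<in> carrier H" "Y (adj H (x ! j) u) \<in> carrier H"
      using xj Y u by simp_all
    then show "ip H ((x ! j \<otimes>\<^bsub>BH H\<^esub> Y \<otimes>\<^bsub>BH H\<^esub> adj H (x ! j)) u) v
        = ip H (Y (adj H (x ! j) u)) (adj H (x ! j) v)"
      using xj u v by (simp add: BH_mult_apply ip_adj)
  qed
qed (use nth_op[OF x] Y u v in auto)

lemma row_closed:
  assumes x: "set x \<subseteq> carrier (BH H)"
  shows "(\<Oplus>\<^bsub>BH H\<^esub>j\<in>{..<length x}. (x ! j) \<otimes>\<^bsub>BH H\<^esub> adj H (x ! j)) \<in> carrier (BH H)"
  using nth_op[OF x] by (intro BH.finsum_closed) auto

lemma ip_row:
  assumes x: "set x \<subseteq> carrier (BH H)" and u: "u \<in> carrier H" and v: "v \<in> carrier H"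
  shows "ip H ((\<Oplus>\<^bsub>BH H\<^esub>j\<in>{..<length x}. (x ! j) \<otimes>\<^bsub>BH H\<^esub> adj H (x ! j)) u) v
    = (\<Sum>j<length x. ip H (adj H (x ! j) u) (adj H (x ! j) v))"
proof (subst ip_finsum_BH)
  show "(\<Sum>j<length x. ip H ((x ! j \<otimes>\<^bsub>BH H\<^esub> adj H (x ! j)) u) v)
      = (\<Sum>j<length x. ip H (adj H (x ! j) u) (adj H (x ! j) v))"
    using nth_op[OF x] adj_nth_in[OF x _ u] u v
    by (intro sum.cong refl) (simp add: BH_mult_apply ip_adj)
qed (use nth_op[OF x] u v in auto)

lemma row_sum_le:
  assumes x: "set x \<subseteq> carrier (BH H)" and u: "u \<in> carrier H"
  shows "(\<Sum>j<length x. (hnorm H (adj H (x ! j) u))\<^sup>2)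
    \<le> opnorm H (\<Oplus>\<^bsub>BH H\<^esub>j\<in>{..<length x}. (x ! j) \<otimes>\<^bsub>BH H\<^esub> adj H (x ! j)) * (hnorm H u)\<^sup>2"
proof -
  let ?R = "\<Oplus>\<^bsub>BH H\<^esub>j\<in>{..<length x}. (x ! j) \<otimes>\<^bsub>BH H\<^esub> adj H (x ! j)"
  have "(\<Sum>j<length x. (hnorm H (adj H (x ! j) u))\<^sup>2) = Re (ip H (?R u) u)"
    using adj_nth_in[OF x _ u] by (simp add: ip_row[OF x u u] Re_ip_self)
  also have "\<dots> \<le> opnorm H ?R * hnorm H u * hnorm H u"
    using norm_ip_le_opnorm[OF row_closed[OF x] u u] complex_Re_le_cmod order_trans by blast
  finally show ?thesis by (simp add: power2_eq_square mult.assoc)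
qed

subsection \<open>Defect operators as quadratic forms\<close>

lemma defect_form_smult:
  assumes "\<And>p. p \<in> set ps \<Longrightarrow> set (snd p) \<subseteq> carrier (BH H)" and "u \<in> carrier H"
  shows "defect_form H ps (c \<odot> u) = (cmod c)\<^sup>2 * defect_form H ps u"
  using assms
proof (induction ps arbitrary: u)
  case Nil
  then show ?case by (simp add: hnorm_smult power_mult_distrib)
next
  case (Cons p ps)
  obtain t x where p: "p = (t, x)" by (cases p)
  have x: "set x \<subseteq> carrier (BH H)" using Cons.prems(1)[of p] p by simp
  have IH: "defect_form H ps (c \<odot> w) = (cmod c)\<^sup>2 * defect_form H ps w" if "w \<in> carrier H" for w
    using Cons.IH[OF Cons.prems(1) that] by simp
  have "adj H (x ! j) (c \<odot> u) = c \<odot> adj H (x ! j) u" if "j < length x" for j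
    using nth_op[OF x that] Cons.prems(2) by (simp add: op_smult)
  then show ?case
    using Cons.prems(2) adj_nth_in[OF x]
    by (simp add: p defect_step_def IH sum_distrib_left right_diff_distrib mult_ac)
qed

text \<open>Scaling the operators by \<open>z\<close> scales their adjoints by \<open>cnj z\<close>; as the form is homogeneous of
  degree two, the effect on every block is the weight \<open>\<bar>z\<bar>\<^sup>2\<close>.\<close>

lemma Delta_scale:
  assumes "\<And>x. x \<in> set X \<Longrightarrow> set x \<subseteq> carrier (BH H)"
  shows "Delta H (scale_tuple H z X) \<one>\<^bsub>BH H\<^esub> \<in> carrier (BH H) \<and>
    (\<forall>u\<in>carrier H. ip H (Delta H (scale_tuple H z X) \<one>\<^bsub>BH H\<^esub> u) u
       = of_real (defect_form H (map (Pair ((cmod z)\<^sup>2)) X) u))"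
  using assms
proof (induction X)
  case Nil
  show ?case by (auto simp: Delta_def scale_tuple_def ip_self)
next
  case (Cons x X)
  define Y where "Y = Delta H (scale_tuple H z X) \<one>\<^bsub>BH H\<^esub>"
  define q where "q = defect_form H (map (Pair ((cmod z)\<^sup>2)) X)"
  define x' where "x' = map (\<lambda>A. z \<odot>\<^bsub>BH H\<^esub> A) x"
  have Y: "Y \<in> carrier (BH H)" and Yq: "\<And>u. u \<in> carrier H \<Longrightarrow> ip H (Y u) u = of_real (q u)"
    using Cons.IH Cons.prems by (simp_all add: Y_def q_def)
  have x: "set x \<subseteq> carrier (BH H)" using Cons.prems by simp
  have x': "set x' \<subseteq> carrier (BH H)" using x by (auto simp: x'_def)
  have Delta: "Delta H (scale_tuple H z (x # X)) \<one>\<^bsub>BH H\<^esub> = Y \<ominus>\<^bsub>BH H\<^esub> Phi H x' Y"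
    by (simp add: Delta_def scale_tuple_def Y_def x'_def)
  have Phi: "Phi H x' Y \<in> carrier (BH H)" by (rule Phi_closed[OF x' Y])
  have "ip H ((Y \<ominus>\<^bsub>BH H\<^esub> Phi H x' Y) u) u = of_real (defect_step H ((cmod z)\<^sup>2) x q u)"
    if u: "u \<in> carrier H" for u
  proof -
    have "ip H (Y (adj H (x' ! j) u)) (adj H (x' ! j) u) = of_real ((cmod z)\<^sup>2 * q (adj H (x ! j) u))"
      if j: "j < length x" for j
    proof -
      have "adj H (x' ! j) u = cnj z \<odot> adj H (x ! j) u"
        using j u nth_op[OF x j] by (simp add: x'_def adj_smult)
      moreover have "q (cnj z \<odot> adj H (x ! j) u) = (cmod (cnj z))\<^sup>2 * q (adj H (x ! j) u)"
        unfolding q_def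
      proof (rule defect_form_smult)
        fix p assume "p \<in> set (map (Pair ((cmod z)\<^sup>2)) X)"
        then obtain y where "y \<in> set X" "p = ((cmod z)\<^sup>2, y)" by auto
        then show "set (snd p) \<subseteq> carrier (BH H)" using Cons.prems by simp
      qed (rule adj_nth_in[OF x j u])
      ultimately show ?thesis
        using Yq[of "cnj z \<odot> adj H (x ! j) u"] adj_nth_in[OF x j u] by simp
    qed
    then have "ip H (Phi H x' Y u) u = of_real (\<Sum>j<length x. (cmod z)\<^sup>2 * q (adj H (x ! j) u))"
      unfolding ip_Phi[OF x' Y u u] of_real_sum by (intro sum.cong) (auto simp: x'_def)
    then show ?thesis
      using Y Phi u by (simp add: BH_minus_apply ip_diff Yq defect_step_def sum_distrib_left)
  qed
  moreover have "Y \<ominus>\<^bsub>BH H\<^esub> Phi H x' Y \<in> carrier (BH H)"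
    using Y Phi by (rule BH.minus_closed)
  ultimately show ?case by (simp add: Delta q_def)
qed

text \<open>Invertibility and positivity of the defect operator, as required in a polyball, amount
  to a positive lower bound of its quadratic form.\<close>

lemma Delta_scale_positive_unit:
  assumes X: "\<And>x. x \<in> set X \<Longrightarrow> set x \<subseteq> carrier (BH H)" and "0 < \<delta>"
    and lower: "\<And>u. u \<in> carrier H
      \<Longrightarrow> \<delta> * (hnorm H u)\<^sup>2 \<le> defect_form H (map (Pair ((cmod z)\<^sup>2)) X) u"
  shows "positive_op H (Delta H (scale_tuple H z X) \<one>\<^bsub>BH H\<^esub>)"
    and "Delta H (scale_tuple H z X) \<one>\<^bsub>BH H\<^esub> \<in> Units (BH H)"
proof -
  let ?T = "Delta H (scale_tuple H z X) \<one>\<^bsub>BH H\<^esub>"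
  have T: "?T \<in> carrier (BH H)"
    and form: "\<And>u. u \<in> carrier H
      \<Longrightarrow> ip H (?T u) u = of_real (defect_form H (map (Pair ((cmod z)\<^sup>2)) X) u)"
    using Delta_scale[OF X] by blast+
  have nonneg: "0 \<le> defect_form H (map (Pair ((cmod z)\<^sup>2)) X) u" if "u \<in> carrier H" for u
    using lower[OF that] \<open>0 < \<delta>\<close> by (meson order_trans mult_nonneg_nonneg less_imp_le zero_le_power2)
  show "positive_op H ?T"
    using T form nonneg by (simp add: positive_op_def)
  show "?T \<in> Units (BH H)"
  proof (rule coercive_imp_unit[OF T _ \<open>0 < \<delta>\<close>])
    show "ip H (?T u) v = ip H u (?T v)" if "u \<in> carrier H" "v \<in> carrier H" for u v
      using form that by (intro hermitian_if_diagonal_real[OF T]) auto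
    show "\<delta> * (hnorm H v)\<^sup>2 \<le> Re (ip H (?T v) v)" if "v \<in> carrier H" for v
      using form[OF that] lower[OF that] by simp
  qed
qed

subsection \<open>Changing the weights\<close>

lemma defect_step_cong:
  assumes "set x \<subseteq> carrier (BH H)" "u \<in> carrier H"
    and "\<And>w. w \<in> carrier H \<Longrightarrow> q w = q' w"
  shows "defect_step H t x q u = defect_step H t x q' u"
  using assms adj_nth_in by (simp add: defect_step_def)

lemma defect_step_commute:
  assumes x: "set x \<subseteq> carrier (BH H)" and y: "set y \<subseteq> carrier (BH H)"
    and comm: "\<forall>A\<in>set x. \<forall>B\<in>set y. A \<otimes>\<^bsub>BH H\<^esub> B = B \<otimes>\<^bsub>BH H\<^esub> A"
    and u: "u \<in> carrier H"
  shows "defect_step H s x (defect_step H t y q) u = defect_step H t y (defect_step H s x q) u"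
proof -
  have "(\<Sum>i<length x. \<Sum>j<length y. q (adj H (y ! j) (adj H (x ! i) u)))
      = (\<Sum>j<length y. \<Sum>i<length x. q (adj H (y ! j) (adj H (x ! i) u)))"
    by (rule sum.swap)
  also have "\<dots> = (\<Sum>j<length y. \<Sum>i<length x. q (adj H (x ! i) (adj H (y ! j) u)))"
  proof (intro sum.cong refl)
    fix j i assume "j \<in> {..<length y}" "i \<in> {..<length x}"
    then have "i < length x" "j < length y" by simp_all
    then have "adj H (x ! i) (adj H (y ! j) u) = adj H (y ! j) (adj H (x ! i) u)"
      using comm u by (intro adj_commute nth_op x y) (meson nth_mem)+
    then show "q (adj H (y ! j) (adj H (x ! i) u)) = q (adj H (x ! i) (adj H (y ! j) u))"
      by simp
  qed
  finally show ?thesis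
    by (simp add: defect_step_def sum_subtractf sum_distrib_left[symmetric] algebra_simps)
qed

lemma defect_form_move_front:
  assumes ps: "\<And>p. p \<in> set ps \<Longrightarrow> set (snd p) \<subseteq> carrier (BH H)" and x: "set x \<subseteq> carrier (BH H)"
    and comm: "\<And>p. p \<in> set ps \<Longrightarrow> \<forall>A\<in>set x. \<forall>B\<in>set (snd p). A \<otimes>\<^bsub>BH H\<^esub> B = B \<otimes>\<^bsub>BH H\<^esub> A"
    and u: "u \<in> carrier H"
  shows "defect_form H (ps @ (t, x) # qs) u = defect_step H t x (defect_form H (ps @ qs)) u"
  using ps comm u
proof (induction ps arbitrary: u)
  case (Cons p ps)
  obtain s y where p: "p = (s, y)" by (cases p)
  have y: "set y \<subseteq> carrier (BH H)" using Cons.prems(1)[of p] p by simp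
  have IH: "defect_form H (ps @ (t, x) # qs) w = defect_step H t x (defect_form H (ps @ qs)) w"
    if "w \<in> carrier H" for w
    by (rule Cons.IH[OF Cons.prems(1)[OF list.set_intros(2)] Cons.prems(2)[OF list.set_intros(2)] that])
  have "defect_form H ((p # ps) @ (t, x) # qs) u
      = defect_step H s y (defect_step H t x (defect_form H (ps @ qs))) u"
    using defect_step_cong[OF y Cons.prems(3) IH] by (simp add: p)
  also have "\<dots> = defect_step H t x (defect_step H s y (defect_form H (ps @ qs))) u"
    using Cons.prems(2)[of p] p x y Cons.prems(3) by (intro defect_step_commute[symmetric]) auto
  finally show ?case by (simp add: p)
qed simp

text \<open>If \<open>\<Phi>\<close> is a strict contraction then \<open>Y \<ge> Y - \<Phi>(Y)\<close> as soon as the right-hand side is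
  positive: iterating \<open>Y \<ge> \<Phi>(Y)\<close> gives \<open>Y \<ge> \<Phi>\<^sup>m(Y)\<close>, and \<open>\<Phi>\<^sup>m(Y)\<close> tends to \<open>0\<close>.\<close>

lemma defect_step_lower_bound:
  assumes x: "set x \<subseteq> carrier (BH H)" and c: "0 \<le> c" "c < 1"
    and contr: "\<And>u. u \<in> carrier H
      \<Longrightarrow> (\<Sum>j<length x. (hnorm H (adj H (x ! j) u))\<^sup>2) \<le> c * (hnorm H u)\<^sup>2"
    and q: "\<And>u. u \<in> carrier H \<Longrightarrow> \<bar>q u\<bar> \<le> K * (hnorm H u)\<^sup>2" and "0 \<le> K"
    and "0 \<le> \<delta>" and step: "\<And>u. u \<in> carrier H \<Longrightarrow> \<delta> * (hnorm H u)\<^sup>2 \<le> defect_step H 1 x q u"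
    and u: "u \<in> carrier H"
  shows "\<delta> * (hnorm H u)\<^sup>2 \<le> q u"
proof -
  have \<delta>: "0 \<le> \<delta> * (hnorm H w)\<^sup>2" for w using \<open>0 \<le> \<delta>\<close> by simp
  have iterate: "- (K * c ^ m * (hnorm H w)\<^sup>2) \<le> q w" if "w \<in> carrier H" for m w
    using that
  proof (induction m arbitrary: w)
    case 0
    then show ?case using q[of w] by simp
  next
    case (Suc m)
    have "- (K * c ^ Suc m * (hnorm H w)\<^sup>2) = - (K * c ^ m) * (c * (hnorm H w)\<^sup>2)"
      by simp
    also have "\<dots> \<le> - (K * c ^ m) * (\<Sum>j<length x. (hnorm H (adj H (x ! j) w))\<^sup>2)"
      using contr[OF Suc.prems] \<open>0 \<le> K\<close> c by (intro mult_left_mono_neg) auto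
    also have "\<dots> = (\<Sum>j<length x. - (K * c ^ m * (hnorm H (adj H (x ! j) w))\<^sup>2))"
      by (simp add: sum_distrib_left sum_negf)
    also have "\<dots> \<le> (\<Sum>j<length x. q (adj H (x ! j) w))"
      using Suc.IH adj_nth_in[OF x _ Suc.prems] by (intro sum_mono) auto
    also have "\<dots> \<le> q w"
      using step[OF Suc.prems] \<delta>[of w] by (simp add: defect_step_def)
    finally show ?case .
  qed
  have nonneg: "0 \<le> q w" if w: "w \<in> carrier H" for w
  proof (rule LIMSEQ_le_const2)
    show "(\<lambda>m. - (K * c ^ m * (hnorm H w)\<^sup>2)) \<longlonglongrightarrow> 0"
      using c by (auto intro!: tendsto_eq_intros LIMSEQ_realpow_zero)
    show "\<exists>N. \<forall>m\<ge>N. - (K * c ^ m * (hnorm H w)\<^sup>2) \<le> q w"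
      using iterate[OF w] by blast
  qed
  have "0 \<le> (\<Sum>j<length x. q (adj H (x ! j) u))"
    using nonneg adj_nth_in[OF x _ u] by (intro sum_nonneg) auto
  then show ?thesis using step[OF u] by (simp add: defect_step_def)
qed

text \<open>For a weight below \<open>1\<close> the form is a convex combination of \<open>q\<close> and of the form of
  weight \<open>1\<close>, so no positivity is lost; for a weight slightly above \<open>1\<close> only little.\<close>

lemma defect_step_change_weight:
  assumes x: "set x \<subseteq> carrier (BH H)" and c: "0 \<le> c" "c < 1"
    and contr: "\<And>u. u \<in> carrier H
      \<Longrightarrow> (\<Sum>j<length x. (hnorm H (adj H (x ! j) u))\<^sup>2) \<le> c * (hnorm H u)\<^sup>2"
    and q: "\<And>u. u \<in> carrier H \<Longrightarrow> \<bar>q u\<bar> \<le> K * (hnorm H u)\<^sup>2" and "0 \<le> K"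
    and "0 \<le> \<delta>" and step: "\<And>u. u \<in> carrier H \<Longrightarrow> \<delta> * (hnorm H u)\<^sup>2 \<le> defect_step H 1 x q u"
    and t: "0 \<le> t" "t \<le> 1 + \<epsilon>" and "0 \<le> \<epsilon>"
    and u: "u \<in> carrier H"
  shows "(\<delta> - \<epsilon> * K) * (hnorm H u)\<^sup>2 \<le> defect_step H t x q u"
proof (cases "t \<le> 1")
  case True
  have "\<delta> * (hnorm H u)\<^sup>2 \<le> q u"
    by (rule defect_step_lower_bound[OF x c contr q \<open>0 \<le> K\<close> \<open>0 \<le> \<delta>\<close> step u])
  then have "(1 - t) * (\<delta> * (hnorm H u)\<^sup>2) + t * (\<delta> * (hnorm H u)\<^sup>2)
      \<le> (1 - t) * q u + t * defect_step H 1 x q u"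
    using t True step[OF u] by (intro add_mono mult_left_mono) auto
  also have "\<dots> = defect_step H t x q u"
    by (simp add: defect_step_def algebra_simps)
  finally have "\<delta> * (hnorm H u)\<^sup>2 \<le> defect_step H t x q u"
    by (simp add: algebra_simps)
  moreover have "0 \<le> \<epsilon> * K * (hnorm H u)\<^sup>2" using \<open>0 \<le> \<epsilon>\<close> \<open>0 \<le> K\<close> by simp
  ultimately show ?thesis by (simp add: left_diff_distrib)
next
  case False
  have "(\<Sum>j<length x. q (adj H (x ! j) u)) \<le> (\<Sum>j<length x. K * (hnorm H (adj H (x ! j) u))\<^sup>2)"
    using q adj_nth_in[OF x _ u] by (intro sum_mono) (simp add: abs_le_iff)
  also have "\<dots> \<le> K * (1 * (hnorm H u)\<^sup>2)"
    unfolding sum_distrib_left[symmetric]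
    using contr[OF u] c \<open>0 \<le> K\<close> mult_right_mono[of c 1 "(hnorm H u)\<^sup>2"]
    by (intro mult_left_mono) auto
  finally have "(t - 1) * (\<Sum>j<length x. q (adj H (x ! j) u)) \<le> (t - 1) * (K * (hnorm H u)\<^sup>2)"
    using False by (intro mult_left_mono) auto
  also have "\<dots> \<le> \<epsilon> * (K * (hnorm H u)\<^sup>2)"
    using t \<open>0 \<le> K\<close> by (intro mult_right_mono) auto
  finally show ?thesis
    using step[OF u] by (simp add: defect_step_def algebra_simps)
qed

lemma defect_form_bound:
  assumes "\<And>p. p \<in> set ps \<Longrightarrow> set (snd p) \<subseteq> carrier (BH H) \<and> 0 \<le> fst p \<and> fst p \<le> 2"
    and "\<And>p u. \<lbrakk>p \<in> set ps; u \<in> carrier H\<rbrakk>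
      \<Longrightarrow> (\<Sum>j<length (snd p). (hnorm H (adj H (snd p ! j) u))\<^sup>2) \<le> (hnorm H u)\<^sup>2"
    and "u \<in> carrier H"
  shows "\<bar>defect_form H ps u\<bar> \<le> 3 ^ length ps * (hnorm H u)\<^sup>2"
  using assms
proof (induction ps arbitrary: u)
  case (Cons p ps)
  obtain t x where p: "p = (t, x)" by (cases p)
  have x: "set x \<subseteq> carrier (BH H)" and t: "0 \<le> t" "t \<le> 2" using Cons.prems(1)[of p] p by auto
  let ?q = "defect_form H ps" and ?K = "3 ^ length ps :: real"
  have IH: "\<bar>?q w\<bar> \<le> ?K * (hnorm H w)\<^sup>2" if "w \<in> carrier H" for w
    using Cons.IH[OF _ _ that] Cons.prems by simp
  have "\<bar>\<Sum>j<length x. ?q (adj H (x ! j) u)\<bar> \<le> (\<Sum>j<length x. ?K * (hnorm H (adj H (x ! j) u))\<^sup>2)"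
    using IH adj_nth_in[OF x _ Cons.prems(3)] by (intro order_trans[OF sum_abs] sum_mono) auto
  also have "\<dots> \<le> ?K * (hnorm H u)\<^sup>2"
    unfolding sum_distrib_left[symmetric]
    using Cons.prems(2)[of p u] Cons.prems(3) p by (intro mult_left_mono) auto
  finally have "t * \<bar>\<Sum>j<length x. ?q (adj H (x ! j) u)\<bar> \<le> 2 * (?K * (hnorm H u)\<^sup>2)"
    using t by (intro mult_mono) auto
  moreover have "\<bar>defect_step H t x ?q u\<bar> \<le> \<bar>?q u\<bar> + t * \<bar>\<Sum>j<length x. ?q (adj H (x ! j) u)\<bar>"
    using t abs_triangle_ineq4[of "?q u" "t * (\<Sum>j<length x. ?q (adj H (x ! j) u))"]
    by (simp add: defect_step_def abs_mult)
  ultimately show ?case using IH[OF Cons.prems(3)] by (simp add: p)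
qed simp

text \<open>Each block is moved to the outermost position, where its weight can be changed at the cost of
  \<open>\<epsilon>\<close> times a bound for the form of the other blocks. Weights up to \<open>2\<close> and contractive blocks bound
  every such form by \<open>3\<^sup>k\<close>: each of the \<open>k\<close> steps at most triples it.\<close>

lemma defect_form_change_weights:
  assumes blocks: "\<And>x. x \<in> set X \<Longrightarrow> set x \<subseteq> carrier (BH H)" and comm: "commuting_blocks H X"
    and c: "0 \<le> c" "c < 1"
    and contr: "\<And>x u. \<lbrakk>x \<in> set X; u \<in> carrier H\<rbrakk>
      \<Longrightarrow> (\<Sum>j<length x. (hnorm H (adj H (x ! j) u))\<^sup>2) \<le> c * (hnorm H u)\<^sup>2"
    and lower: "\<And>u. u \<in> carrier H \<Longrightarrow> \<delta> * (hnorm H u)\<^sup>2 \<le> defect_form H (map (Pair 1) X) u"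
    and t: "0 \<le> t" "t \<le> 1 + \<epsilon>" and \<epsilon>: "0 \<le> \<epsilon>" "\<epsilon> \<le> 1"
    and small: "real (length X) * \<epsilon> * 3 ^ length X \<le> \<delta>"
    and u: "u \<in> carrier H"
  shows "(\<delta> - real (length X) * \<epsilon> * 3 ^ length X) * (hnorm H u)\<^sup>2 \<le> defect_form H (map (Pair t) X) u"
proof -
  define K :: real where "K = 3 ^ length X"
  \<comment> \<open>the weights of the blocks in \<open>xs\<close> have been changed, those in \<open>ys\<close> not yet\<close>
  have "(\<delta> - real (length xs) * \<epsilon> * K) * (hnorm H u)\<^sup>2
      \<le> defect_form H (map (Pair t) xs @ map (Pair 1) ys) u"
    if "X = xs @ ys" "u \<in> carrier H" for xs ys u
    using that
  proof (induction xs arbitrary: ys u rule: rev_induct)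
    case Nil
    then show ?case using lower by simp
  next
    case (snoc x xs)
    define q where "q = defect_form H (map (Pair t) xs @ map (Pair 1) ys)"
    have X: "X = xs @ x # ys" using snoc.prems by simp
    have x: "set x \<subseteq> carrier (BH H)" using blocks X by simp
    have comm_x: "\<forall>A\<in>set x. \<forall>B\<in>set y. A \<otimes>\<^bsub>BH H\<^esub> B = B \<otimes>\<^bsub>BH H\<^esub> A" if y: "y \<in> set xs" for y
    proof -
      obtain s where s: "s < length xs" "xs ! s = y" using y by (auto simp: in_set_conv_nth)
      then have "X ! s = y" "X ! length xs = x" "s < length X" "length xs < length X"
        by (auto simp: X nth_append)
      then show ?thesis using comm s(1) unfolding commuting_blocks_def by blast
    qed
    have move: "defect_form H (map (Pair t) xs @ (s, x) # map (Pair 1) ys) w = defect_step H s x q w"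
      if "w \<in> carrier H" for s w
      unfolding q_def
    proof (rule defect_form_move_front[OF _ x _ that])
      fix p assume "p \<in> set (map (Pair t) xs)"
      then obtain y where y: "y \<in> set xs" "p = (t, y)" by auto
      then show "set (snd p) \<subseteq> carrier (BH H)" using blocks[of y] X by simp
      show "\<forall>A\<in>set x. \<forall>B\<in>set (snd p). A \<otimes>\<^bsub>BH H\<^esub> B = B \<otimes>\<^bsub>BH H\<^esub> A"
        using comm_x[OF y(1)] y(2) by simp
    qed
    have "(\<delta> - real (length xs) * \<epsilon> * K - \<epsilon> * K) * (hnorm H u)\<^sup>2 \<le> defect_step H t x q u"
    proof (rule defect_step_change_weight[OF x c contr])
      show "x \<in> set X" by (simp add: X)
      show "0 \<le> K" by (simp add: K_def)
      show "\<bar>q w\<bar> \<le> K * (hnorm H w)\<^sup>2" if w: "w \<in> carrier H" for w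
      proof -
        have contr1: "(\<Sum>j<length y. (hnorm H (adj H (y ! j) v))\<^sup>2) \<le> (hnorm H v)\<^sup>2"
          if "y \<in> set X" "v \<in> carrier H" for y v
          using contr[OF that] mult_right_mono[of c 1 "(hnorm H v)\<^sup>2"] c by simp
        have "\<bar>q w\<bar> \<le> 3 ^ length (map (Pair t) xs @ map (Pair 1) ys) * (hnorm H w)\<^sup>2"
          unfolding q_def
        proof (rule defect_form_bound[OF _ _ w])
          fix p assume "p \<in> set (map (Pair t) xs @ map (Pair 1) ys)"
          then have p: "snd p \<in> set X" "fst p = t \<or> fst p = 1" using X by auto
          show "set (snd p) \<subseteq> carrier (BH H) \<and> 0 \<le> fst p \<and> fst p \<le> 2"
            using blocks[OF p(1)] p(2) t \<epsilon> by auto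
          show "(\<Sum>j<length (snd p). (hnorm H (adj H (snd p ! j) v))\<^sup>2) \<le> (hnorm H v)\<^sup>2"
            if "v \<in> carrier H" for v
            using contr1[OF p(1) that] .
        qed
        also have "\<dots> \<le> K * (hnorm H w)\<^sup>2"
          unfolding K_def by (intro mult_right_mono power_increasing) (auto simp: X)
        finally show ?thesis .
      qed
      have "real (length xs) * (\<epsilon> * K) \<le> real (length X) * (\<epsilon> * K)"
        using \<epsilon> by (intro mult_right_mono) (auto simp: X K_def)
      then show "0 \<le> \<delta> - real (length xs) * \<epsilon> * K"
        using small by (simp add: K_def mult.assoc)
      show "(\<delta> - real (length xs) * \<epsilon> * K) * (hnorm H w)\<^sup>2 \<le> defect_step H 1 x q w"
        if "w \<in> carrier H" for w
        using snoc.IH[of "x # ys" w] move[of w 1] that X by simp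
    qed (use t \<epsilon> snoc.prems in auto)
    then show ?case using move[of u t] snoc.prems by (simp add: algebra_simps)
  qed
  from this[of X "[]" u] show ?thesis using u by (simp add: K_def)
qed

subsection \<open>A disc through every point\<close>

lemma scale_tuple_commuting:
  assumes blocks: "\<And>x. x \<in> set X \<Longrightarrow> set x \<subseteq> carrier (BH H)" and comm: "commuting_blocks H X"
  shows "commuting_blocks H (scale_tuple H z X)"
proof -
  have "(z \<odot>\<^bsub>BH H\<^esub> A) \<otimes>\<^bsub>BH H\<^esub> (z \<odot>\<^bsub>BH H\<^esub> B) = (z \<odot>\<^bsub>BH H\<^esub> B) \<otimes>\<^bsub>BH H\<^esub> (z \<odot>\<^bsub>BH H\<^esub> A)"
    if "s < length X" "t < length X" "s \<noteq> t" "A \<in> set (X ! s)" "B \<in> set (X ! t)" for s t A B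
  proof (rule op_eqI)
    have A: "A \<in> carrier (BH H)" and B: "B \<in> carrier (BH H)"
      using blocks that by (meson nth_mem subsetD)+
    have AB: "A \<otimes>\<^bsub>BH H\<^esub> B = B \<otimes>\<^bsub>BH H\<^esub> A"
      using comm that unfolding commuting_blocks_def by blast
    fix v assume v: "v \<in> carrier H"
    have "A (B v) = B (A v)" using AB v by (metis BH_mult_apply)
    then show "((z \<odot>\<^bsub>BH H\<^esub> A) \<otimes>\<^bsub>BH H\<^esub> (z \<odot>\<^bsub>BH H\<^esub> B)) v = ((z \<odot>\<^bsub>BH H\<^esub> B) \<otimes>\<^bsub>BH H\<^esub> (z \<odot>\<^bsub>BH H\<^esub> A)) v"
      using A B v by (simp add: BH_mult_apply BH_smult_apply op_smult)
  qed (use blocks that in \<open>auto intro!: BH_mult_closed BH_smult_closed dest: nth_mem\<close>)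
  then show ?thesis unfolding commuting_blocks_def scale_tuple_def by auto
qed

lemma opnorm_row_scale:
  assumes x: "set x \<subseteq> carrier (BH H)"
  shows "opnorm H (\<Oplus>\<^bsub>BH H\<^esub>j\<in>{..<length (map (\<lambda>A. z \<odot>\<^bsub>BH H\<^esub> A) x)}.
      (map (\<lambda>A. z \<odot>\<^bsub>BH H\<^esub> A) x ! j) \<otimes>\<^bsub>BH H\<^esub> adj H (map (\<lambda>A. z \<odot>\<^bsub>BH H\<^esub> A) x ! j))
    \<le> (cmod z)\<^sup>2 * opnorm H (\<Oplus>\<^bsub>BH H\<^esub>j\<in>{..<length x}. (x ! j) \<otimes>\<^bsub>BH H\<^esub> adj H (x ! j))"
    (is "opnorm H ?R' \<le> _ * opnorm H ?R")
proof (rule opnorm_leI)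
  fix v assume v: "v \<in> carrier H" "hnorm H v \<le> 1"
  let ?x' = "map (\<lambda>A. z \<odot>\<^bsub>BH H\<^esub> A) x"
  have x': "set ?x' \<subseteq> carrier (BH H)" using x by auto
  have R: "?R \<in> carrier (BH H)" and R': "?R' \<in> carrier (BH H)"
    by (rule row_closed[OF x], rule row_closed[OF x'])
  have "?R' v = of_real ((cmod z)\<^sup>2) \<odot> ?R v"
  proof (rule vector_eqI)
    fix w assume w: "w \<in> carrier H"
    have "ip H (?R' v) w = (\<Sum>j<length x. ip H (adj H (?x' ! j) v) (adj H (?x' ! j) w))"
      unfolding ip_row[OF x' v(1) w] by simp
    also have "\<dots> = (\<Sum>j<length x. of_real ((cmod z)\<^sup>2) * ip H (adj H (x ! j) v) (adj H (x ! j) w))"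
    proof (intro sum.cong refl)
      fix j assume "j \<in> {..<length x}"
      then have j: "j < length x" by simp
      show "ip H (adj H (?x' ! j) v) (adj H (?x' ! j) w)
          = of_real ((cmod z)\<^sup>2) * ip H (adj H (x ! j) v) (adj H (x ! j) w)"
        using nth_op[OF x j] j v w unfolding complex_norm_square
        by (simp add: adj_smult ip_simps)
    qed
    also have "\<dots> = ip H (of_real ((cmod z)\<^sup>2) \<odot> ?R v) w"
      using R v w by (simp add: ip_smult ip_row[OF x] sum_distrib_left)
    finally show "ip H (?R' v) w = ip H (of_real ((cmod z)\<^sup>2) \<odot> ?R v) w" .
  qed (use R R' v in auto)
  then have "hnorm H (?R' v) = (cmod z)\<^sup>2 * hnorm H (?R v)"
    using R v by (simp add: hnorm_smult norm_power)
  also have "hnorm H (?R v) \<le> opnorm H ?R * 1"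
    using hnorm_le_opnorm[OF R v(1)] mult_left_mono[OF v(2) opnorm_nonneg[OF R]] by linarith
  finally show "hnorm H (?R' v) \<le> (cmod z)\<^sup>2 * opnorm H ?R"
    by (simp add: mult_left_mono)
qed

lemma scale_tuple_one:
  assumes "\<And>x. x \<in> set X \<Longrightarrow> set x \<subseteq> carrier (BH H)"
  shows "scale_tuple H 1 X = X"
proof -
  have "1 \<odot>\<^bsub>BH H\<^esub> A = A" if "A \<in> carrier (BH H)" for A
    using that smult_one by (intro op_eqI) (auto simp: BH_smult_apply)
  then show ?thesis using assms
    unfolding scale_tuple_def by (intro map_idI) (auto intro!: map_idI)
qed

text \<open>The phase of \<open>z\<close> does not matter, all moduli up to \<open>1\<close> are admissible, and the margin left by
  the strict inequalities and by the lower bound \<open>\<delta>\<close> of the defect operator allows moduli slightly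
  above \<open>1\<close>. The excess is needed to make \<open>X\<close> itself an interior point of the disc.\<close>

lemma polyball_disc:
  assumes X: "X \<in> polyball H n"
  obtains \<rho> where "1 < \<rho>" "\<And>z. cmod z \<le> \<rho> \<Longrightarrow> scale_tuple H z X \<in> polyball H n"
proof -
  let ?row = "\<lambda>x. \<Oplus>\<^bsub>BH H\<^esub>j\<in>{..<length x}. (x ! j) \<otimes>\<^bsub>BH H\<^esub> adj H (x ! j)"
  have blocks: "\<And>x. x \<in> set X \<Longrightarrow> set x \<subseteq> carrier (BH H)" and comm: "commuting_blocks H X"
    and row: "\<And>x. x \<in> set X \<Longrightarrow> opnorm H (?row x) < 1"
    and pos: "positive_op H (Delta H X \<one>\<^bsub>BH H\<^esub>)" and unit: "Delta H X \<one>\<^bsub>BH H\<^esub> \<in> Units (BH H)"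
    and n: "map length X = n"
    using X unfolding polyball_def commuting_blocks_def by blast+
  define c where "c = Max (insert 0 ((\<lambda>x. opnorm H (?row x)) ` set X))"
  have c: "0 \<le> c" "c < 1" and row_c: "\<And>x. x \<in> set X \<Longrightarrow> opnorm H (?row x) \<le> c"
    using row by (auto simp: c_def)
  have contr: "(\<Sum>j<length x. (hnorm H (adj H (x ! j) u))\<^sup>2) \<le> c * (hnorm H u)\<^sup>2"
    if "x \<in> set X" "u \<in> carrier H" for x u
    using row_sum_le[OF blocks[OF that(1)] that(2)] mult_right_mono[OF row_c[OF that(1)], of "(hnorm H u)\<^sup>2"]
    by simp
  obtain \<delta> where \<delta>: "0 < \<delta>"
    and coercive: "\<And>u. u \<in> carrier H \<Longrightarrow> \<delta> * (hnorm H u)\<^sup>2 \<le> Re (ip H (Delta H X \<one>\<^bsub>BH H\<^esub> u) u)"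
    using positive_unit_imp_coercive[OF pos unit] by metis
  have lower: "\<delta> * (hnorm H u)\<^sup>2 \<le> defect_form H (map (Pair 1) X) u" if "u \<in> carrier H" for u
    using coercive[OF that] Delta_scale[OF blocks, of X 1] that by (simp add: scale_tuple_one[OF blocks])
  define N where "N = real (length X) * 3 ^ length X"
  \<comment> \<open>the three bounds keep the weights at most \<open>2\<close>, the loss of positivity at most \<open>\<delta> / 2\<close>, and the rows
    strictly contractive\<close>
  define \<epsilon> where "\<epsilon> = min 1 (min (\<delta> / (2 * (N + 1))) ((1 - c) / 2))"
  have "0 \<le> N" by (simp add: N_def)
  have \<epsilon>: "0 < \<epsilon>" "\<epsilon> \<le> 1" "\<epsilon> \<le> \<delta> / (2 * (N + 1))" "\<epsilon> \<le> (1 - c) / 2"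
  proof -
    show "0 < \<epsilon>" using \<delta> c \<open>0 \<le> N\<close> by (simp add: \<epsilon>_def)
    show "\<epsilon> \<le> 1" unfolding \<epsilon>_def by (rule min.cobounded1)
    show "\<epsilon> \<le> \<delta> / (2 * (N + 1))"
      unfolding \<epsilon>_def by (rule min.coboundedI2[OF min.cobounded1])
    show "\<epsilon> \<le> (1 - c) / 2"
      unfolding \<epsilon>_def by (rule min.coboundedI2[OF min.cobounded2])
  qed
  have "\<epsilon> * (2 * (N + 1)) \<le> \<delta>" using \<epsilon>(3) \<open>0 \<le> N\<close> by (simp add: pos_le_divide_eq)
  then have small: "real (length X) * \<epsilon> * 3 ^ length X \<le> \<delta> / 2"
    using \<epsilon>(1) by (simp add: N_def algebra_simps)
  define \<rho> where "\<rho> = sqrt (1 + \<epsilon>)"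
  show thesis
  proof (rule that)
    show "1 < \<rho>" using \<epsilon> by (simp add: \<rho>_def)
    fix z assume "cmod z \<le> \<rho>"
    then have "(cmod z)\<^sup>2 \<le> \<rho>\<^sup>2" by (intro power_mono) auto
    then have z: "(cmod z)\<^sup>2 \<le> 1 + \<epsilon>" using \<epsilon> by (simp add: \<rho>_def)
    have "(\<delta> / 2) * (hnorm H u)\<^sup>2 \<le> defect_form H (map (Pair ((cmod z)\<^sup>2)) X) u"
      if u: "u \<in> carrier H" for u
    proof -
      have "(\<delta> / 2) * (hnorm H u)\<^sup>2 \<le> (\<delta> - real (length X) * \<epsilon> * 3 ^ length X) * (hnorm H u)\<^sup>2"
        using small by (intro mult_right_mono) auto
      also have "\<dots> \<le> defect_form H (map (Pair ((cmod z)\<^sup>2)) X) u"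
        using small \<delta> \<epsilon> z u lower
        by (intro defect_form_change_weights[OF blocks comm c contr]) auto
      finally show ?thesis .
    qed
    then have "positive_op H (Delta H (scale_tuple H z X) \<one>\<^bsub>BH H\<^esub>)"
      "Delta H (scale_tuple H z X) \<one>\<^bsub>BH H\<^esub> \<in> Units (BH H)"
      using Delta_scale_positive_unit[OF blocks, of X "\<delta> / 2" z] \<delta> by auto
    moreover have "map length (scale_tuple H z X) = n"
      using n by (simp add: scale_tuple_def o_def)
    moreover have "\<forall>y\<in>set (scale_tuple H z X). set y \<subseteq> carrier (BH H)"
      using blocks by (auto simp: scale_tuple_def)
    moreover have "\<forall>y\<in>set (scale_tuple H z X). opnorm H (?row y) < 1"
    proof
      fix y assume "y \<in> set (scale_tuple H z X)"
      then obtain x where x: "x \<in> set X" and y: "y = map (\<lambda>A. z \<odot>\<^bsub>BH H\<^esub> A) x"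
        by (auto simp: scale_tuple_def)
      have "opnorm H (?row y) \<le> (cmod z)\<^sup>2 * opnorm H (?row x)"
        unfolding y by (rule opnorm_row_scale[OF blocks[OF x]])
      also have "\<dots> \<le> (1 + \<epsilon>) * c"
        using z row_c[OF x] opnorm_nonneg[OF row_closed[OF blocks[OF x]]] \<epsilon> by (intro mult_mono) auto
      also have "\<dots> \<le> c + \<epsilon>"
        using c \<epsilon> mult_left_mono[of c 1 \<epsilon>] by (simp add: algebra_simps)
      also have "\<dots> < 1" using \<epsilon>(4) c(2) by (simp add: field_simps)
      finally show "opnorm H (?row y) < 1" .
    qed
    moreover have "commuting_blocks H (scale_tuple H z X)"
      by (rule scale_tuple_commuting[OF blocks comm])
    ultimately show "scale_tuple H z X \<in> polyball H n"
      unfolding polyball_def commuting_blocks_def by blast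
  qed
qed

end

section \<open>Functions of one complex variable\<close>

text \<open>Convergence at the single point \<open>\<rho>\<close> dominates the whole disc, so the Weierstrass test applies to
  the unordered sum directly and the terms of equal degree need not be collected.\<close>

lemma graded_series_holomorphic:
  fixes c :: "'i \<Rightarrow> complex" and d :: "'i \<Rightarrow> nat"
  assumes "0 \<le> \<rho>" and f: "\<And>z. cmod z \<le> \<rho> \<Longrightarrow> ((\<lambda>p. z ^ d p * c p) has_sum f z) I"
  shows "f holomorphic_on ball 0 \<rho>"
proof -
  have "(\<lambda>p. of_real \<rho> ^ d p * c p) summable_on I"
    using f[of "of_real \<rho>"] \<open>0 \<le> \<rho>\<close> by (auto intro: has_sum_imp_summable)
  then have summable: "(\<lambda>p. cmod (of_real \<rho> ^ d p * c p)) summable_on I"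
    by (simp add: summable_on_iff_abs_summable_on_complex)
  have "uniform_limit (cball 0 \<rho>) (\<lambda>P z. \<Sum>p\<in>P. z ^ d p * c p) f (finite_subsets_at_top I)"
  proof (rule Weierstrass_m_test_general'[OF _ _ summable])
    show "cmod (z ^ d p * c p) \<le> cmod (of_real \<rho> ^ d p * c p)" if "z \<in> cball 0 \<rho>" for p z
      using that \<open>0 \<le> \<rho>\<close> by (auto simp: norm_mult norm_power intro!: mult_right_mono power_mono)
    show "((\<lambda>p. z ^ d p * c p) has_sum f z) I" if "z \<in> cball 0 \<rho>" for z
      using f that by simp
  qed
  then show ?thesis
    by (rule holomorphic_uniform_limit[rotated])
      (auto intro!: always_eventually continuous_intros holomorphic_intros)
qed

text \<open>The Schwarz-Pick inequality between the points \<open>0\<close> and \<open>\<xi>\<close>, solved for \<open>\<bar>g \<xi>\<bar>\<close> only partly: in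
  this form the right-hand side increases with \<open>\<bar>g 0\<bar>\<close>, so that a bound can replace \<open>\<bar>g 0\<bar>\<close>.\<close>

lemma Schwarz_Pick_centre:
  assumes hol: "g holomorphic_on ball 0 1" and g: "\<And>w. cmod w < 1 \<Longrightarrow> cmod (g w) < 1"
    and \<xi>: "cmod \<xi> < 1"
  shows "cmod (g \<xi>) \<le> cmod \<xi> + cmod (g 0) * (1 - cmod \<xi> * cmod (g \<xi>))"
proof -
  define a b where "a = g 0" and "b = g \<xi>"
  define x y r where "x = cmod a" and "y = cmod b" and "r = cmod \<xi>"
  have x: "0 \<le> x" "x < 1" and y: "0 \<le> y" "y < 1" and r: "0 \<le> r" "r < 1"
    using g[of 0] g[of \<xi>] \<xi> by (auto simp: x_def y_def r_def a_def b_def)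
  define h where "h = Moebius_function 0 a \<circ> g"
  have "h holomorphic_on ball 0 1"
    unfolding h_def using g x
    by (intro holomorphic_on_compose_gen[OF hol Moebius_function_holomorphic])
       (auto simp: x_def)
  then have "cmod (h \<xi>) \<le> r"
    unfolding r_def
  proof (rule Schwarz_Lemma(1))
    show "h 0 = 0" by (simp add: h_def a_def Moebius_function_eq_zero)
    show "cmod (h w) < 1" if "cmod w < 1" for w
      using g[OF that] x by (simp add: h_def x_def Moebius_function_norm_lt_1)
  qed (use \<xi> in auto)
  moreover have xy: "x * y < 1"
    using x y mult_strict_mono[of x 1 y 1] by (cases "y = 0") auto
  have D: "1 - x * y \<le> cmod (1 - cnj a * b)"
    using norm_triangle_ineq2[of 1 "cnj a * b"] by (simp add: x_def y_def norm_mult)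
  moreover have "0 < cmod (1 - cnj a * b)" using D xy by linarith
  ultimately have "cmod (b - a) \<le> r * cmod (1 - cnj a * b)"
    by (simp add: h_def Moebius_function_simple b_def[symmetric] norm_divide pos_divide_le_eq)
  then have "(cmod (b - a))\<^sup>2 \<le> r\<^sup>2 * (cmod (1 - cnj a * b))\<^sup>2"
    by (metis norm_ge_zero power_mono power_mult_distrib)
  moreover have "(cmod (1 - cnj a * b))\<^sup>2 - (cmod (b - a))\<^sup>2 = (1 - x\<^sup>2) * (1 - y\<^sup>2)"
    unfolding x_def y_def cmod_power2 by (simp add: power2_eq_square algebra_simps)
  ultimately have "(1 - r\<^sup>2) * (cmod (1 - cnj a * b))\<^sup>2 \<le> (1 - x\<^sup>2) * (1 - y\<^sup>2)"
    by (simp add: algebra_simps)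
  moreover have "(1 - r\<^sup>2) * (1 - x * y)\<^sup>2 \<le> (1 - r\<^sup>2) * (cmod (1 - cnj a * b))\<^sup>2"
    using D xy r by (intro mult_left_mono power_mono) (auto simp: power_le_one)
  moreover have "(1 - x\<^sup>2) * (1 - y\<^sup>2) = (1 - x * y)\<^sup>2 - (y - x)\<^sup>2"
    by (simp add: power2_eq_square algebra_simps)
  ultimately have "(1 - r\<^sup>2) * (1 - x * y)\<^sup>2 \<le> (1 - x * y)\<^sup>2 - (y - x)\<^sup>2"
    by linarith
  then have "(y - x)\<^sup>2 \<le> (r * (1 - x * y))\<^sup>2"
    by (simp add: power_mult_distrib left_diff_distrib)
  then have "y - x \<le> r * (1 - x * y)"
    by (rule power2_le_imp_le) (use r xy in simp)
  then show ?thesis by (simp add: x_def y_def r_def a_def b_def algebra_simps)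
qed

text \<open>After rescaling to the unit disc, Schwarz-Pick bounds \<open>\<bar>f 1\<bar>\<close> by \<open>M (M / \<rho> + s) / (M + s / \<rho>)\<close>,
  which is less than \<open>M\<close> when \<open>0 \<le> s < M\<close>. This gap is the same for all such functions, which is what a
  supremum over infinitely many of them needs.\<close>

lemma quantitative_maximum_principle:
  assumes hol: "f holomorphic_on ball 0 \<rho>" and "1 < \<rho>"
    and bound: "\<And>z. cmod z < \<rho> \<Longrightarrow> cmod (f z) \<le> M"
    and centre: "cmod (f 0) \<le> s"
  shows "cmod (f 1) * (M + s / \<rho>) \<le> M * (M / \<rho> + s)"
proof -
  have "cmod (f 0) \<le> M" using bound[of 0] \<open>1 < \<rho>\<close> by simp
  then have "0 \<le> M" using norm_ge_zero order_trans by blast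
  \<comment> \<open>the Schwarz lemma asks for a strict bound, so \<open>M\<close> is approached from above\<close>
  have "cmod (f 1) * (N + s / \<rho>) \<le> N * (N / \<rho> + s)" if N: "M < N" for N
  proof -
    have "0 < N" using N \<open>0 \<le> M\<close> by simp
    define g where "g w = f (of_real \<rho> * w) / of_real N" for w
    have disc: "cmod (of_real \<rho> * w) < \<rho>" if "cmod w < 1" for w
      using that \<open>1 < \<rho>\<close> by (simp add: norm_mult)
    have "(\<lambda>w. f (of_real \<rho> * w)) holomorphic_on ball 0 1"
    proof -
      have "(\<lambda>w. complex_of_real \<rho> * w) ` ball 0 1 \<subseteq> ball 0 \<rho>" using disc by auto
      moreover have "(\<lambda>w. of_real \<rho> * w) holomorphic_on ball 0 1" by (intro holomorphic_intros)
      ultimately have "f \<circ> (\<lambda>w. of_real \<rho> * w) holomorphic_on ball 0 1"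
        using holomorphic_on_compose_gen[OF _ hol] by blast
      then show ?thesis by (simp add: o_def)
    qed
    then have "g holomorphic_on ball 0 1"
      unfolding g_def using \<open>0 < N\<close> by (intro holomorphic_intros) auto
    moreover have "cmod (g w) < 1" if "cmod w < 1" for w
      using bound[OF disc[OF that]] N \<open>0 < N\<close> by (simp add: g_def norm_divide)
    moreover have "cmod (of_real (1 / \<rho>)) < 1"
      using \<open>1 < \<rho>\<close> by (simp add: norm_divide)
    ultimately have "cmod (g (of_real (1 / \<rho>)))
        \<le> cmod (of_real (1 / \<rho>)) + cmod (g 0) * (1 - cmod (of_real (1 / \<rho>)) * cmod (g (of_real (1 / \<rho>))))"
      by (rule Schwarz_Pick_centre)
    moreover have "cmod (g (of_real (1 / \<rho>))) = cmod (f 1) / N" "cmod (g 0) = cmod (f 0) / N"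
      using \<open>1 < \<rho>\<close> \<open>0 < N\<close> by (auto simp: g_def norm_divide)
    moreover have "cmod (of_real (1 / \<rho>)) = 1 / \<rho>" using \<open>1 < \<rho>\<close> by (simp add: norm_divide)
    ultimately have *: "cmod (f 1) / N \<le> 1 / \<rho> + cmod (f 0) / N * (1 - 1 / \<rho> * (cmod (f 1) / N))"
      by simp
    have "cmod (f 1) \<le> N * \<rho>"
    proof -
      have "cmod (f 1) \<le> N * 1" using bound[of 1] \<open>1 < \<rho>\<close> N by simp
      also have "\<dots> \<le> N * \<rho>" using \<open>1 < \<rho>\<close> \<open>0 < N\<close> by (intro mult_left_mono) auto
      finally show ?thesis .
    qed
    then have "0 \<le> 1 - 1 / \<rho> * (cmod (f 1) / N)"
      using \<open>1 < \<rho>\<close> \<open>0 < N\<close> by (simp add: field_simps)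
    then have "cmod (f 0) / N * (1 - 1 / \<rho> * (cmod (f 1) / N)) \<le> s / N * (1 - 1 / \<rho> * (cmod (f 1) / N))"
      using centre \<open>0 < N\<close> by (intro mult_right_mono divide_right_mono) auto
    with * have "cmod (f 1) / N \<le> 1 / \<rho> + s / N * (1 - 1 / \<rho> * (cmod (f 1) / N))"
      by linarith
    then have "N\<^sup>2 * (cmod (f 1) / N) \<le> N\<^sup>2 * (1 / \<rho> + s / N * (1 - 1 / \<rho> * (cmod (f 1) / N)))"
      by (intro mult_left_mono) auto
    then show ?thesis
      using \<open>0 < N\<close> by (simp add: power2_eq_square algebra_simps)
  qed
  then have "\<forall>\<^sub>F N in at_right M. cmod (f 1) * (N + s / \<rho>) \<le> N * (N / \<rho> + s)"
    by (rule eventually_mono[OF eventually_at_right_less])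
  moreover have "((\<lambda>N. cmod (f 1) * (N + s / \<rho>)) \<longlongrightarrow> cmod (f 1) * (M + s / \<rho>)) (at_right M)"
    "((\<lambda>N. N * (N / \<rho> + s)) \<longlongrightarrow> M * (M / \<rho> + s)) (at_right M)"
    using \<open>1 < \<rho>\<close> by (auto intro!: tendsto_intros)
  ultimately show ?thesis
    using tendsto_le[OF trivial_limit_at_right_real] by blast
qed


section \<open>Evaluating the series along a disc\<close>

lemma finite_multiwords: "finite (multiwords n p)"
proof (rule finite_subset)
  let ?W = "{w. set w \<subseteq> {..<sum_list n} \<and> length w \<le> sum_list p}"
  show "finite {\<alpha>. set \<alpha> \<subseteq> ?W \<and> length \<alpha> = length p}"
    by (intro finite_lists_length_eq finite_lists_length_le) simp
  show "multiwords n p \<subseteq> {\<alpha>. set \<alpha> \<subseteq> ?W \<and> length \<alpha> = length p}"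
  proof (safe)
    fix \<alpha> assume \<alpha>: "\<alpha> \<in> multiwords n p"
    then show "length \<alpha> = length p" by (auto simp: multiwords_def)
    fix w assume w: "w \<in> set \<alpha>"
    then obtain i where i: "i < length \<alpha>" "w = \<alpha> ! i" by (metis in_set_conv_nth)
    have "length w \<in> set p" using \<alpha> w by (auto simp: multiwords_def)
    then show "length w \<le> sum_list p" by (simp add: member_le_sum_list)
    have "set w \<subseteq> {..<n ! i}" "n ! i \<in> set n"
      using \<alpha> i by (auto simp: multiwords_def list_all2_conv_all_nth)
    moreover have "n ! i \<le> sum_list n"
      using \<open>n ! i \<in> set n\<close> by (simp add: member_le_sum_list)
    ultimately show "j < sum_list n" if "j \<in> set w" for j
      using that by fastforce
  qed
qed

lemma multiwords_zero: "multiwords n (replicate (length n) 0) = {replicate (length n) []}"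
proof -
  have "map length \<alpha> = replicate (length n) 0 \<longleftrightarrow> \<alpha> = replicate (length n) []" for \<alpha> :: "nat list list"
  proof
    assume \<alpha>: "map length \<alpha> = replicate (length n) 0"
    show "\<alpha> = replicate (length n) []"
    proof (rule replicate_eqI)
      show "length \<alpha> = length n" using arg_cong[OF \<alpha>, of length] by simp
      fix w assume "w \<in> set \<alpha>"
      then have "length w \<in> set (replicate (length n) 0)" using \<alpha> by (metis image_eqI set_map)
      then show "w = []" by simp
    qed
  qed simp
  moreover have "list_all2 (\<lambda>w m. set w \<subseteq> {..<m}) (replicate (length n) []) n"
    by (simp add: list_all2_conv_all_nth)
  ultimately show ?thesis by (auto simp: multiwords_def)
qed

context hilbert_space
begin

lemma op_word_closed:
  assumes "set x \<subseteq> carrier (BH H)" "set w \<subseteq> {..<length x}"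
  shows "op_word H x w \<in> carrier (BH H)"
  using assms(2) nth_op[OF assms(1)] by (induction w) (auto simp: op_word_def)

lemma op_word_scale:
  assumes x: "set x \<subseteq> carrier (BH H)" and w: "set w \<subseteq> {..<length x}" and v: "v \<in> carrier H"
  shows "op_word H (map (\<lambda>A. z \<odot>\<^bsub>BH H\<^esub> A) x) w v = z ^ length w \<odot> op_word H x w v"
  using w
proof (induction w)
  case Nil
  then show ?case using v smult_one by (simp add: op_word_def)
next
  case (Cons j w)
  let ?x' = "map (\<lambda>A. z \<odot>\<^bsub>BH H\<^esub> A) x"
  have j: "j < length x" and w: "set w \<subseteq> {..<length x}" using Cons.prems by auto
  have W: "op_word H x w v \<in> carrier H" using op_word_closed[OF x w] v by simp
  have xj: "x ! j \<in> carrier (BH H)" using nth_op[OF x j] .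
  have "op_word H ?x' (j # w) v = (z \<odot>\<^bsub>BH H\<^esub> (x ! j)) (op_word H ?x' w v)"
    using j v by (simp add: op_word_def BH_mult_apply)
  also have "\<dots> = z \<odot> (z ^ length w \<odot> (x ! j) (op_word H x w v))"
    by (simp only: Cons.IH[OF w] BH_smult_apply[OF smult_in[OF W]] op_smult[OF xj W])
  also have "\<dots> = z ^ length (j # w) \<odot> (x ! j) (op_word H x w v)"
    using smult_assoc1[of z "z ^ length w"] xj W by simp
  also have "(x ! j) (op_word H x w v) = op_word H x (j # w) v"
    using v by (simp add: op_word_def BH_mult_apply)
  finally show ?case .
qed

lemma op_multiword_scale:
  assumes "list_all2 (\<lambda>x w. set x \<subseteq> carrier (BH H) \<and> set w \<subseteq> {..<length x}) X \<alpha>"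
  shows "op_multiword H X \<alpha> \<in> carrier (BH H) \<and>
    (\<forall>v\<in>carrier H. op_multiword H (scale_tuple H z X) \<alpha> v
       = z ^ sum_list (map length \<alpha>) \<odot> op_multiword H X \<alpha> v)"
  using assms
proof (induction rule: list_all2_induct)
  case Nil
  then show ?case using smult_one by (auto simp: op_multiword_def scale_tuple_def)
next
  case (Cons x X w \<alpha>)
  have x: "set x \<subseteq> carrier (BH H)" and w: "set w \<subseteq> {..<length x}" using Cons by auto
  have W: "op_word H x w \<in> carrier (BH H)" by (rule op_word_closed[OF x w])
  have M: "op_multiword H X \<alpha> \<in> carrier (BH H)" using Cons by blast
  have eq: "op_multiword H (x # X) (w # \<alpha>) = op_word H x w \<otimes>\<^bsub>BH H\<^esub> op_multiword H X \<alpha>"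
    by (simp add: op_multiword_def)
  have "op_multiword H (scale_tuple H z (x # X)) (w # \<alpha>) v
      = z ^ sum_list (map length (w # \<alpha>)) \<odot> op_multiword H (x # X) (w # \<alpha>) v"
    if v: "v \<in> carrier H" for v
  proof -
    let ?u = "op_multiword H X \<alpha> v"
    have u: "?u \<in> carrier H" using M v by simp
    have "op_multiword H (scale_tuple H z (x # X)) (w # \<alpha>) v
        = op_word H (map (\<lambda>A. z \<odot>\<^bsub>BH H\<^esub> A) x) w (op_multiword H (scale_tuple H z X) \<alpha> v)"
      using v by (simp add: op_multiword_def scale_tuple_def BH_mult_apply)
    also have "op_multiword H (scale_tuple H z X) \<alpha> v = z ^ sum_list (map length \<alpha>) \<odot> ?u"
      using Cons v by blast
    also have "op_word H (map (\<lambda>A. z \<odot>\<^bsub>BH H\<^esub> A) x) w (z ^ sum_list (map length \<alpha>) \<odot> ?u)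
        = z ^ length w \<odot> (z ^ sum_list (map length \<alpha>) \<odot> op_word H x w ?u)"
      using op_word_scale[OF x w] u W by (simp add: op_smult)
    also have "\<dots> = z ^ sum_list (map length (w # \<alpha>)) \<odot> op_word H x w ?u"
      using smult_assoc1[of "z ^ length w" "z ^ sum_list (map length \<alpha>)"] u W by (simp add: power_add)
    finally show ?thesis using v by (simp add: eq BH_mult_apply)
  qed
  then show ?case using W M by (simp add: eq)
qed

lemma multiword_letters:
  assumes X: "\<And>x. x \<in> set X \<Longrightarrow> set x \<subseteq> carrier (BH H)" and n: "map length X = n"
    and \<alpha>: "\<alpha> \<in> multiwords n p"
  shows "list_all2 (\<lambda>x w. set x \<subseteq> carrier (BH H) \<and> set w \<subseteq> {..<length x}) X \<alpha>"
proof (rule list_all2_all_nthI)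
  have \<alpha>': "list_all2 (\<lambda>w m. set w \<subseteq> {..<m}) \<alpha> n" using \<alpha> by (simp add: multiwords_def)
  show len: "length X = length \<alpha>" using list_all2_lengthD[OF \<alpha>'] n by auto
  fix i assume i: "i < length X"
  have "set (\<alpha> ! i) \<subseteq> {..<n ! i}" using list_all2_nthD[OF \<alpha>'] i len by simp
  moreover have "n ! i = length (X ! i)" using i n by auto
  ultimately show "set (X ! i) \<subseteq> carrier (BH H) \<and> set (\<alpha> ! i) \<subseteq> {..<length (X ! i)}"
    using X[OF nth_mem[OF i]] by simp
qed

lemma homogeneous_part_closed:
  assumes X: "\<And>x. x \<in> set X \<Longrightarrow> set x \<subseteq> carrier (BH H)" and n: "map length X = n"
  shows "homogeneous_part H n a X p \<in> carrier (BH H)"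
  unfolding homogeneous_part_def using op_multiword_scale multiword_letters[OF X n]
  by (intro BH.finsum_closed) blast

lemma ip_homogeneous_part:
  assumes X: "\<And>x. x \<in> set X \<Longrightarrow> set x \<subseteq> carrier (BH H)" and n: "map length X = n"
    and u: "u \<in> carrier H" and v: "v \<in> carrier H"
  shows "ip H (homogeneous_part H n a X p u) v
    = (\<Sum>\<alpha>\<in>multiwords n p. a \<alpha> * ip H (op_multiword H X \<alpha> u) v)"
proof -
  have M: "op_multiword H X \<alpha> \<in> carrier (BH H)" if "\<alpha> \<in> multiwords n p" for \<alpha>
    using op_multiword_scale multiword_letters[OF X n that] by blast
  show ?thesis
    unfolding homogeneous_part_def
    by (subst ip_finsum_BH) (use finite_multiwords M u v in \<open>auto simp: BH_smult_apply ip_smult\<close>)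
qed

lemma scale_tuple_blocks:
  assumes X: "\<And>x. x \<in> set X \<Longrightarrow> set x \<subseteq> carrier (BH H)"
  shows "\<And>x. x \<in> set (scale_tuple H z X) \<Longrightarrow> set x \<subseteq> carrier (BH H)"
    and "map length (scale_tuple H z X) = map length X"
proof -
  fix x assume "x \<in> set (scale_tuple H z X)"
  then obtain y where "y \<in> set X" "x = map (\<lambda>A. z \<odot>\<^bsub>BH H\<^esub> A) y" by (auto simp: scale_tuple_def)
  then show "set x \<subseteq> carrier (BH H)" using X[of y] by auto
qed (simp add: scale_tuple_def)

lemma ip_homogeneous_part_scale:
  assumes X: "\<And>x. x \<in> set X \<Longrightarrow> set x \<subseteq> carrier (BH H)" and n: "map length X = n"
    and u: "u \<in> carrier H" and v: "v \<in> carrier H"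
  shows "ip H (homogeneous_part H n a (scale_tuple H z X) p u) v
    = z ^ sum_list p * ip H (homogeneous_part H n a X p u) v"
proof -
  have "ip H (op_multiword H (scale_tuple H z X) \<alpha> u) v = z ^ sum_list p * ip H (op_multiword H X \<alpha> u) v"
    if \<alpha>: "\<alpha> \<in> multiwords n p" for \<alpha>
  proof -
    have "map length \<alpha> = p" using \<alpha> by (simp add: multiwords_def)
    then show ?thesis
      using op_multiword_scale[OF multiword_letters[OF X n \<alpha>], of z] u v by (simp add: ip_smult)
  qed
  then show ?thesis
    using scale_tuple_blocks[OF X] n u v
    by (simp add: ip_homogeneous_part[OF X n] ip_homogeneous_part[OF scale_tuple_blocks(1)[OF X]]
        sum_distrib_left mult.left_commute)
qed

text \<open>Matrix coefficients are continuous in operator norm; through them the series of operators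
  becomes a family of absolutely convergent series of complex numbers.\<close>

lemma series_weak_has_sum:
  assumes X: "\<And>x. x \<in> set X \<Longrightarrow> set x \<subseteq> carrier (BH H)" and n: "map length X = n"
    and T: "series_converges_to H n a X T" and u: "u \<in> carrier H" and v: "v \<in> carrier H"
  shows "((\<lambda>p. ip H (homogeneous_part H n a X p u) v) has_sum ip H (T u) v) {p. length p = length n}"
proof -
  let ?F = "homogeneous_part H n a X"
  let ?S = "\<lambda>P. \<Oplus>\<^bsub>BH H\<^esub>p\<in>P. ?F p"
  have TB: "T \<in> carrier (BH H)"
    and lim: "((\<lambda>P. opnorm H (?S P \<ominus>\<^bsub>BH H\<^esub> T)) \<longlongrightarrow> 0) (finite_subsets_at_top {p. length p = length n})"
    using T by (simp_all add: series_converges_to_def op_has_sum_def)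
  have S: "?S P \<in> carrier (BH H)" for P
    using homogeneous_part_closed[OF X n] by (intro BH.finsum_closed) auto
  have bound: "cmod ((\<Sum>p\<in>P. ip H (?F p u) v) - ip H (T u) v)
      \<le> opnorm H (?S P \<ominus>\<^bsub>BH H\<^esub> T) * (hnorm H u * hnorm H v)" if "finite P" for P
  proof -
    have "(\<Sum>p\<in>P. ip H (?F p u) v) - ip H (T u) v = ip H ((?S P \<ominus>\<^bsub>BH H\<^esub> T) u) v"
      using that u v S[of P] TB homogeneous_part_closed[OF X n]
      by (simp add: BH_minus_apply ip_diff ip_finsum_BH)
    then show ?thesis
      using norm_ip_le_opnorm[OF BH.minus_closed[OF S[of P] TB] u v] by (simp add: mult.assoc)
  qed
  have "((\<lambda>P. (\<Sum>p\<in>P. ip H (?F p u) v) - ip H (T u) v) \<longlongrightarrow> 0)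
      (finite_subsets_at_top {p. length p = length n})"
  proof (rule Lim_null_comparison)
    show "\<forall>\<^sub>F P in finite_subsets_at_top {p. length p = length n}.
        cmod ((\<Sum>p\<in>P. ip H (?F p u) v) - ip H (T u) v)
        \<le> opnorm H (?S P \<ominus>\<^bsub>BH H\<^esub> T) * (hnorm H u * hnorm H v)"
      using bound by (auto intro: eventually_finite_subsets_at_top_weakI)
    show "((\<lambda>P. opnorm H (?S P \<ominus>\<^bsub>BH H\<^esub> T) * (hnorm H u * hnorm H v)) \<longlongrightarrow> 0)
        (finite_subsets_at_top {p. length p = length n})"
      using tendsto_mult_right[OF lim] by simp
  qed
  then show ?thesis unfolding has_sum_def by (rule LIM_zero_cancel)
qed

lemma free_eval_converges:
  assumes X: "\<And>x. x \<in> set X \<Longrightarrow> set x \<subseteq> carrier (BH H)" and n: "map length X = n"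
    and ex: "\<exists>T. series_converges_to H n a X T"
  shows "series_converges_to H n a X (free_eval H n a X)"
proof -
  have "T = T'" if T: "series_converges_to H n a X T" and T': "series_converges_to H n a X T'" for T T'
  proof (rule op_eqI)
    show TB: "T \<in> carrier (BH H)" "T' \<in> carrier (BH H)"
      using T T' by (simp_all add: series_converges_to_def op_has_sum_def)
    show "T u = T' u" if u: "u \<in> carrier H" for u
    proof (rule vector_eqI)
      show "ip H (T u) v = ip H (T' u) v" if v: "v \<in> carrier H" for v
        using has_sum_unique[OF series_weak_has_sum[OF X n T u v] series_weak_has_sum[OF X n T' u v]] .
    qed (use TB u in auto)
  qed
  then have "\<exists>!T. series_converges_to H n a X T" using ex by blast
  from theI'[OF this] show ?thesis unfolding free_eval_def .
qed

lemma ip_constant_part: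
  assumes X: "\<And>x. x \<in> set X \<Longrightarrow> set x \<subseteq> carrier (BH H)" and n: "map length X = n"
    and u: "u \<in> carrier H" and v: "v \<in> carrier H"
  shows "ip H (homogeneous_part H n a X (replicate (length n) 0) u) v
    = a (replicate (length n) []) * ip H u v"
proof -
  have *: "op_multiword H X (replicate (length X) []) u = u"
    using u
  proof (induction X)
    case (Cons x X)
    then show ?case by (simp add: op_multiword_def op_word_def BH_mult_apply)
  qed (simp add: op_multiword_def)
  have "op_multiword H X (replicate (length n) []) u = u"
    using * n by auto
  then show ?thesis using u v by (simp add: ip_homogeneous_part[OF X n] multiwords_zero)
qed

text \<open>The matrix coefficients of \<open>z \<mapsto> F(z X)\<close> are holomorphic on a disc with \<open>1\<close> in its interior,
  and at the centre they do not see \<open>X\<close>: there \<open>F(0)\<close> is the constant coefficient of the series.\<close>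

lemma matrix_coefficient_along_disc:
  assumes conv: "\<And>Y. Y \<in> polyball H n \<Longrightarrow> \<exists>T. series_converges_to H n a Y T"
    and X: "X \<in> polyball H n"
  obtains \<rho> where "1 < \<rho>" "\<And>z. cmod z < \<rho> \<Longrightarrow> scale_tuple H z X \<in> polyball H n"
    "scale_tuple H 1 X = X"
    "\<And>u v. \<lbrakk>u \<in> carrier H; v \<in> carrier H\<rbrakk> \<Longrightarrow>
       (\<lambda>z. ip H (free_eval H n a (scale_tuple H z X) u) v) holomorphic_on ball 0 \<rho>"
    "\<And>u v. \<lbrakk>u \<in> carrier H; v \<in> carrier H\<rbrakk> \<Longrightarrow>
       ip H (free_eval H n a (scale_tuple H 0 X) u) v = a (replicate (length n) []) * ip H u v"
proof -
  have blocks: "\<And>x. x \<in> set X \<Longrightarrow> set x \<subseteq> carrier (BH H)" and n: "map length X = n"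
    using X unfolding polyball_def by blast+
  obtain \<rho> where "1 < \<rho>" and disc: "\<And>z. cmod z \<le> \<rho> \<Longrightarrow> scale_tuple H z X \<in> polyball H n"
    using polyball_disc[OF X] by metis
  have sums: "((\<lambda>p. z ^ sum_list p * ip H (homogeneous_part H n a X p u) v)
      has_sum ip H (free_eval H n a (scale_tuple H z X) u) v) {p. length p = length n}"
    if z: "cmod z \<le> \<rho>" and u: "u \<in> carrier H" and v: "v \<in> carrier H" for z u v
  proof -
    have blocks': "\<And>x. x \<in> set (scale_tuple H z X) \<Longrightarrow> set x \<subseteq> carrier (BH H)"
      and n': "map length (scale_tuple H z X) = n"
      using disc[OF z] unfolding polyball_def by blast+
    have "series_converges_to H n a (scale_tuple H z X) (free_eval H n a (scale_tuple H z X))"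
      by (rule free_eval_converges[OF blocks' n' conv[OF disc[OF z]]])
    from series_weak_has_sum[OF blocks' n' this u v]
    show ?thesis by (simp only: ip_homogeneous_part_scale[OF blocks n u v])
  qed
  show thesis
  proof (rule that[OF \<open>1 < \<rho>\<close>])
    show "scale_tuple H z X \<in> polyball H n" if "cmod z < \<rho>" for z
      using disc that by simp
    show "scale_tuple H 1 X = X" by (rule scale_tuple_one[OF blocks])
    fix u v assume u: "u \<in> carrier H" and v: "v \<in> carrier H"
    show "(\<lambda>z. ip H (free_eval H n a (scale_tuple H z X) u) v) holomorphic_on ball 0 \<rho>"
      using \<open>1 < \<rho>\<close> sums[OF _ u v] by (intro graded_series_holomorphic) auto
    let ?k = "length n" and ?F = "\<lambda>p. ip H (homogeneous_part H n a X p u) v"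
    have "p = replicate ?k 0" if "length p = ?k" "sum_list p = 0" for p :: "nat list"
      using that by (auto intro!: replicate_eqI simp: sum_list_eq_0_iff)
    then have "((\<lambda>p. 0 ^ sum_list p * ?F p) has_sum ip H (free_eval H n a (scale_tuple H 0 X) u) v)
        {p. length p = ?k} \<longleftrightarrow> (?F has_sum ip H (free_eval H n a (scale_tuple H 0 X) u) v) {replicate ?k 0}"
      by (intro has_sum_cong_neutral) (auto simp: power_0_left)
    then have "(?F has_sum ip H (free_eval H n a (scale_tuple H 0 X) u) v) {replicate ?k 0}"
      using sums[of 0, OF _ u v] \<open>1 < \<rho>\<close> by simp
    then have "ip H (free_eval H n a (scale_tuple H 0 X) u) v = ?F (replicate ?k 0)"
      by (rule has_sum_unique) (use has_sum_finite[of "{replicate ?k 0}" ?F] in simp)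
    then show "ip H (free_eval H n a (scale_tuple H 0 X) u) v = a (replicate (length n) []) * ip H u v"
      by (simp only: ip_constant_part[OF blocks n u v])
  qed
qed

lemma free_eval_closed:
  assumes conv: "\<And>Y. Y \<in> polyball H n \<Longrightarrow> \<exists>T. series_converges_to H n a Y T"
    and X: "X \<in> polyball H n"
  shows "free_eval H n a X \<in> carrier (BH H)"
proof -
  have blocks: "\<And>x. x \<in> set X \<Longrightarrow> set x \<subseteq> carrier (BH H)" and n: "map length X = n"
    using X unfolding polyball_def by blast+
  show ?thesis
    using free_eval_converges[OF blocks n conv[OF X]]
    by (simp add: series_converges_to_def op_has_sum_def)
qed


section \<open>The maximum principle\<close>

text \<open>The operator norm need not be attained at a vector, so that no single matrix coefficient of
  \<open>F\<close> has to be maximal at \<open>X\<^sub>0\<close>. The gap in the quantitative maximum principle is the same for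
  all matrix coefficients and therefore survives the supremum.\<close>

lemma maximum_le_constant_coefficient:
  assumes conv: "\<And>Y. Y \<in> polyball H n \<Longrightarrow> \<exists>T. series_converges_to H n a Y T"
    and X0: "X0 \<in> polyball H n"
    and max: "\<And>X. X \<in> polyball H n \<Longrightarrow> opnorm H (free_eval H n a X) \<le> opnorm H (free_eval H n a X0)"
  shows "opnorm H (free_eval H n a X0) \<le> cmod (a (replicate (length n) []))"
proof -
  define M s where "M = opnorm H (free_eval H n a X0)" and "s = cmod (a (replicate (length n) []))"
  obtain \<rho> where "1 < \<rho>" and disc: "\<And>z. cmod z < \<rho> \<Longrightarrow> scale_tuple H z X0 \<in> polyball H n"
    and one: "scale_tuple H 1 X0 = X0"
    and hol: "\<And>u v. \<lbrakk>u \<in> carrier H; v \<in> carrier H\<rbrakk> \<Longrightarrow>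
       (\<lambda>z. ip H (free_eval H n a (scale_tuple H z X0) u) v) holomorphic_on ball 0 \<rho>"
    and zero: "\<And>u v. \<lbrakk>u \<in> carrier H; v \<in> carrier H\<rbrakk> \<Longrightarrow>
       ip H (free_eval H n a (scale_tuple H 0 X0) u) v = a (replicate (length n) []) * ip H u v"
    by (rule matrix_coefficient_along_disc[OF conv X0], assumption, rule that)
  have closed: "free_eval H n a X \<in> carrier (BH H)" if "X \<in> polyball H n" for X
    by (rule free_eval_closed[OF conv that])
  have "0 \<le> M" unfolding M_def by (rule opnorm_nonneg[OF closed[OF X0]])
  have "0 \<le> s" by (simp add: s_def)
  have key: "cmod (ip H (free_eval H n a X0 u) v) * (M + s / \<rho>) \<le> M * (M / \<rho> + s)"
    if u: "u \<in> carrier H" "hnorm H u \<le> 1" and v: "v \<in> carrier H" "hnorm H v \<le> 1" for u v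
  proof -
    have uv: "hnorm H u * hnorm H v \<le> 1" using u v by (simp add: mult_le_one)
    have "cmod (ip H (free_eval H n a (scale_tuple H 1 X0) u) v) * (M + s / \<rho>) \<le> M * (M / \<rho> + s)"
    proof (rule quantitative_maximum_principle[OF hol[OF u(1) v(1)] \<open>1 < \<rho>\<close>])
      show "cmod (ip H (free_eval H n a (scale_tuple H z X0) u) v) \<le> M" if z: "cmod z < \<rho>" for z
      proof -
        have "cmod (ip H (free_eval H n a (scale_tuple H z X0) u) v)
            \<le> opnorm H (free_eval H n a (scale_tuple H z X0)) * (hnorm H u * hnorm H v)"
          using norm_ip_le_opnorm[OF closed[OF disc[OF z]] u(1) v(1)] by (simp add: mult.assoc)
        also have "\<dots> \<le> M * 1"
          unfolding M_def using max[OF disc[OF z]] uv u v opnorm_nonneg[OF closed[OF X0]]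
          by (intro mult_mono) auto
        finally show ?thesis by simp
      qed
      have "cmod (ip H u v) \<le> 1" using Cauchy_Schwarz[OF u(1) v(1)] uv by simp
      then show "cmod (ip H (free_eval H n a (scale_tuple H 0 X0) u) v) \<le> s"
        using zero[OF u(1) v(1)] mult_left_mono[of "cmod (ip H u v)" 1 s] \<open>0 \<le> s\<close>
        by (simp add: norm_mult s_def)
    qed
    then show ?thesis by (simp add: one)
  qed
  have "M \<le> s"
  proof (cases "M + s / \<rho> = 0")
    case True
    then show ?thesis using \<open>0 \<le> M\<close> \<open>0 \<le> s\<close> \<open>1 < \<rho>\<close> by (smt (verit) divide_nonneg_pos)
  next
    case False
    then have pos: "0 < M + s / \<rho>"
      using \<open>0 \<le> M\<close> \<open>0 \<le> s\<close> \<open>1 < \<rho>\<close> by (smt (verit) divide_nonneg_pos)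
    define \<theta> where "\<theta> = M * (M / \<rho> + s) / (M + s / \<rho>)"
    have "0 \<le> \<theta>" using \<open>0 \<le> M\<close> \<open>0 \<le> s\<close> \<open>1 < \<rho>\<close> by (simp add: \<theta>_def)
    have "M \<le> \<theta>"
      unfolding M_def
    proof (rule opnorm_leI)
      fix u assume u: "u \<in> carrier H" "hnorm H u \<le> 1"
      show "hnorm H (free_eval H n a X0 u) \<le> \<theta>"
      proof (rule ip_norm_le_imp_hnorm_le[OF _ \<open>0 \<le> \<theta>\<close>])
        show "free_eval H n a X0 u \<in> carrier H" using closed[OF X0] u by simp
        show "cmod (ip H (free_eval H n a X0 u) v) \<le> \<theta>" if "v \<in> carrier H" "hnorm H v \<le> 1" for v
          using key[OF u that] pos by (simp add: \<theta>_def pos_le_divide_eq)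
      qed
    qed
    then have "M * (M + s / \<rho>) \<le> M * (M / \<rho> + s)"
      using pos by (simp add: \<theta>_def pos_le_divide_eq)
    show "M \<le> s"
    proof (cases "M = 0")
      case False
      then have "M + s / \<rho> \<le> M / \<rho> + s"
        using \<open>M * (M + s / \<rho>) \<le> M * (M / \<rho> + s)\<close> \<open>0 \<le> M\<close> by simp
      then have "\<rho> * (M + s / \<rho>) \<le> \<rho> * (M / \<rho> + s)"
        using \<open>1 < \<rho>\<close> by (intro mult_left_mono) auto
      then have "M * (\<rho> - 1) \<le> s * (\<rho> - 1)"
        using \<open>1 < \<rho>\<close> by (simp add: algebra_simps)
      then show ?thesis using \<open>1 < \<rho>\<close> by simp
    qed (use \<open>0 \<le> s\<close> in simp)
  qed
  then show ?thesis by (simp add: M_def s_def)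
qed

text \<open>For a bound by the constant coefficient the diagonal coefficient \<open>\<langle>F(z X) u, u\<rangle>\<close> is maximal at
  the centre, hence constant, and \<open>\<parallel>F(X) u\<parallel> \<le> \<parallel>a\<^sub>0 u\<parallel>\<close> with \<open>\<langle>F(X) u, a\<^sub>0 u\<rangle> = \<parallel>a\<^sub>0 u\<parallel>\<^sup>2\<close> is the equality
  case of Cauchy-Schwarz.\<close>

lemma bounded_by_constant_coefficient:
  assumes conv: "\<And>Y. Y \<in> polyball H n \<Longrightarrow> \<exists>T. series_converges_to H n a Y T"
    and bound: "\<And>X. X \<in> polyball H n \<Longrightarrow> opnorm H (free_eval H n a X) \<le> cmod (a (replicate (length n) []))"
    and X: "X \<in> polyball H n"
  shows "free_eval H n a X = a (replicate (length n) []) \<odot>\<^bsub>BH H\<^esub> \<one>\<^bsub>BH H\<^esub>"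
proof -
  define b where "b = a (replicate (length n) [])"
  obtain \<rho> where "1 < \<rho>" and disc: "\<And>z. cmod z < \<rho> \<Longrightarrow> scale_tuple H z X \<in> polyball H n"
    and one: "scale_tuple H 1 X = X"
    and hol: "\<And>u v. \<lbrakk>u \<in> carrier H; v \<in> carrier H\<rbrakk> \<Longrightarrow>
       (\<lambda>z. ip H (free_eval H n a (scale_tuple H z X) u) v) holomorphic_on ball 0 \<rho>"
    and zero': "\<And>u v. \<lbrakk>u \<in> carrier H; v \<in> carrier H\<rbrakk> \<Longrightarrow>
       ip H (free_eval H n a (scale_tuple H 0 X) u) v = a (replicate (length n) []) * ip H u v"
    by (rule matrix_coefficient_along_disc[OF conv X], assumption, rule that)
  note zero = zero'[folded b_def]
  have closed: "free_eval H n a Y \<in> carrier (BH H)" if "Y \<in> polyball H n" for Y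
    by (rule free_eval_closed[OF conv that])
  have "free_eval H n a X u = b \<odot> u" if u: "u \<in> carrier H" for u
  proof -
    let ?f = "\<lambda>z. ip H (free_eval H n a (scale_tuple H z X) u) u"
    have "cmod (?f z) \<le> cmod (?f 0)" if z: "z \<in> ball 0 \<rho>" for z
    proof -
      have zX: "scale_tuple H z X \<in> polyball H n" using disc z by simp
      have "cmod (?f z) \<le> opnorm H (free_eval H n a (scale_tuple H z X)) * (hnorm H u * hnorm H u)"
        using norm_ip_le_opnorm[OF closed[OF zX] u u] by (simp add: mult.assoc)
      also have "\<dots> \<le> cmod b * (hnorm H u * hnorm H u)"
        using bound[OF zX] by (intro mult_right_mono) (auto simp: b_def)
      also have "\<dots> = cmod (?f 0)"
        using u by (simp add: zero norm_mult ip_self norm_power power2_eq_square)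
      finally show ?thesis .
    qed
    then have "?f constant_on ball 0 \<rho>"
      using \<open>1 < \<rho>\<close> by (intro maximum_modulus_principle[OF hol[OF u u], of "ball 0 \<rho>" 0]) auto
    then have "?f 1 = ?f 0"
      using \<open>1 < \<rho>\<close> unfolding constant_on_def by auto
    then have diag: "ip H (free_eval H n a X u) u = b * of_real ((hnorm H u)\<^sup>2)"
      using u by (simp add: one zero ip_self)
    define w where "w = free_eval H n a X u"
    have w: "w \<in> carrier H" unfolding w_def using closed[OF X] u by simp
    have "ip H w (b \<odot> u) = cnj b * (b * of_real ((hnorm H u)\<^sup>2))"
      using w u diag by (simp add: ip_smult_right w_def)
    also have "\<dots> = of_real ((cmod b)\<^sup>2 * (hnorm H u)\<^sup>2)"
      by (simp only: complex_norm_square of_real_mult mult_ac)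
    finally have "Re (ip H w (b \<odot> u)) = (cmod b * hnorm H u)\<^sup>2"
      by (simp add: power_mult_distrib)
    moreover have "hnorm H w \<le> cmod b * hnorm H u"
      using hnorm_le_opnorm[OF closed[OF X] u] mult_right_mono[OF bound[OF X] hnorm_nonneg[OF u]]
      by (simp add: w_def b_def)
    then have "(hnorm H w)\<^sup>2 \<le> (cmod b * hnorm H u)\<^sup>2"
      using w by (intro power_mono) auto
    ultimately have "(hnorm H (w \<ominus> b \<odot> u))\<^sup>2 \<le> 0"
      using w u by (simp add: hnorm_diff_square hnorm_smult)
    then have "w \<ominus> b \<odot> u = \<zero>"
      using w u hnorm_eq_0[of "w \<ominus> b \<odot> u"] by simp
    then have "w = b \<odot> u" using w u minus_eq_zero_imp_eq by blast
    then show ?thesis by (simp add: w_def)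
  qed
  then show ?thesis
    using closed[OF X] unfolding b_def[symmetric]
    by (intro op_eqI) (auto simp: BH_smult_apply)
qed

end

theorem theorem2p8:
  fixes n :: "nat list" and H :: "'v hilbert" and a :: "nat list list \<Rightarrow> complex"
    and X0 :: "('v \<Rightarrow> 'v) list list"
  assumes "n \<noteq> []" and "\<forall>m\<in>set n. 1 \<le> m"
    and "hilbert_space H"
    and "free_holomorphic TYPE('v) n a" and "free_bounded TYPE('v) n a"
    and "X0 \<in> polyball H n"
    and "\<forall>X\<in>polyball H n. opnorm H (free_eval H n a X) \<le> opnorm H (free_eval H n a X0)"
  shows "free_eval H n a constant_on polyball H n"
proof -
  interpret hilbert_space H by fact
  have conv: "\<exists>T. series_converges_to H n a Y T" if "Y \<in> polyball H n" for Y
    using assms(3,4) that unfolding free_holomorphic_def by blast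
  have "opnorm H (free_eval H n a X) \<le> cmod (a (replicate (length n) []))" if "X \<in> polyball H n" for X
    using maximum_le_constant_coefficient[OF conv assms(6)] assms(7) that by (meson order_trans)
  then show ?thesis
    unfolding constant_on_def using bounded_by_constant_coefficient[OF conv] by blast
qed

end
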